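(* Let $f$ be either (non-critical case) a $(q,r)$-extendable probability generating function with $f'(r)<\infty$, with $\psi_{q,r}$ the function $$\psi_{q,r}(x)=\frac{f^{(4)}(q,q,r,x)-\gamma f^{(4)}(q,r,r,x)}{f^{(3)}(q,r,x)},\quad x\in[0,r),\qquad\alpha=1-f'(q),\ \ \gamma=\frac{\alpha}{f'(r)-1},$$ or (critical case, $q=r=1$) a probability generating function with $f(1)=f'(1)=1$ and $f'''(1)<\infty$, with $$\psi_{1,1}(x)=\frac{f_4^2(x)}{m_2^2f_3(x)}-\frac{f_5(x)}{m_2^2},\quad x\in[0,1).$$ Then $\psi_{q,r}(x)\equiv0$ if and only if $f$ is modified linear-fractional, i.e. $$f(s)=p_0+p_1s+(1-p_0-p_1-p_\Delta)s^2(1-p)(1-ps)^{-1},\quad s\in[0,p^{-1}),$$ for some $p_0,p_1,p_\Delta,p\in[0,1)$ with $p_0+p_1+p_\Delta<1$. If $f$ has this form, then the probability generating function $F_t(s)=\mathrm{E}(s^{Z_t})$ of the corresponding branching process satisfies, in the non-critical case, for $s\in[0,q)\cup(q,r)$ and $t\ge0$, $$\frac{F_t(s)-q}{s-q}=e^{-\alpha t}\Big\{\frac{r-F_t(s)}{r-s}\Big\}^\gamma,$$ and in the critical case, where $f(s)=s+p_0(1-s)^2(1-ps)^{-1}$, for $s\in[0,1)$ and $t\ge0$, $$p_0t=(1-p)\frac{F_t(s)-s}{(1-s)(1-F_t(s))}-p\ln\frac{1-F_t(s)}{1-s}.$$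
   Context: Branching process: $f(s)=\sum_{k\ge0}p_ks^k$ with $p_k\ge0$, $f(1)\le1$, $p_1\ne1$ (a possibly defective probability generating function). $\{Z_t\}_{t\ge0}$ is the continuous-time Markov branching process with $Z_0=1$: particles have independent exponential life lengths with parameter 1; at death a particle is, independently of everything else, replaced by $k$ particles with probability $p_k$, $k\ge0$, while with probability $1-f(1)$ it sends the whole process to an absorbing graveyard state $\Delta$; $s^\Delta=0$, so $F_t(s)=\sum_{k\ge0}\mathrm{P}(Z_t=k)s^k$. $f$ is $(q,r)$-extendable, where $0\le q\le1\le r<\infty$, $q<r$, if $f(q)=q$ and $f(r)=r$. Tail generating functions: for $v(s)=\sum_{k\ge0}v_ks^k$ with all $v_k\ge0$ and $n\ge1$, $$v^{(n)}(s_1,\ldots,s_n)=\sum_{i_1\ge0,\ldots,i_n\ge0}v_{i_1+\cdots+i_n+n-1}\,s_1^{i_1}\cdots s_n^{i_n}.$$ In the critical case, $m_2=f''(1)/2$, $m_3=f'''(1)/6$ and, for $x\in[0,1)$, $f_3(x)=\frac{f(x)-x}{(1-x)^2}$, $f_4(x)=\frac{m_2-f_3(x)}{1-x}$, $f_5(x)=\frac{m_3-f_4(x)}{1-x}$. *)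

theory Defs
  imports "HOL-Probability.Probability"
begin

section \<open>Generating functions\<close>

definition gf :: "(nat \<Rightarrow> real) \<Rightarrow> real \<Rightarrow> real" where
  "gf v s = (\<Sum>k. v k * s ^ k)"

text \<open>
  Derivatives are taken termwise: \<^term>\<open>gf (diffs v) s\<close> is the derivative of \<^term>\<open>gf v\<close>
  at \<open>s\<close>. For a nonnegative sequence this also covers a right end point of the domain of
  convergence, where the value is the left derivative, which is finite iff the termwise
  differentiated series is summable.
\<close>

text \<open>The tail generating function; its order \<open>n \<ge> 1\<close> is the length of the argument list.\<close>

definition tail_gf :: "(nat \<Rightarrow> real) \<Rightarrow> real list \<Rightarrow> real" where
  "tail_gf v ss =
     (\<Sum>\<^sub>\<infinity> is \<in> {is :: nat list. length is = length ss}.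
        v (sum_list is + length ss - 1) * (\<Prod>j<length ss. (ss ! j) ^ (is ! j)))"

text \<open>A possibly defective offspring law; \<open>p k\<close> is the probability of \<open>k\<close> offspring.\<close>

definition offspring_law :: "(nat \<Rightarrow> real) \<Rightarrow> bool" where
  "offspring_law p \<longleftrightarrow> (\<forall>k. 0 \<le> p k) \<and> summable p \<and> (\<Sum>k. p k) \<le> 1 \<and> p 1 \<noteq> 1"

definition extendable :: "(nat \<Rightarrow> real) \<Rightarrow> real \<Rightarrow> real \<Rightarrow> bool" where
  "extendable p q r \<longleftrightarrow>
     0 \<le> q \<and> q \<le> 1 \<and> 1 \<le> r \<and> q < r \<and>
     (\<lambda>k. p k * q ^ k) sums q \<and> (\<lambda>k. p k * r ^ k) sums r"

definition noncritical :: "(nat \<Rightarrow> real) \<Rightarrow> real \<Rightarrow> real \<Rightarrow> bool" where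
  "noncritical p q r \<longleftrightarrow> extendable p q r \<and> summable (\<lambda>k. diffs p k * r ^ k)"

text \<open>The critical case: \<open>f(1) = f'(1) = 1\<close> and \<open>f'''(1) < \<infinity>\<close>.\<close>

definition critical :: "(nat \<Rightarrow> real) \<Rightarrow> bool" where
  "critical p \<longleftrightarrow> p sums 1 \<and> diffs p sums 1 \<and> summable (diffs (diffs (diffs p)))"


section \<open>The functions \<open>\<psi>\<close>\<close>

definition alpha :: "(nat \<Rightarrow> real) \<Rightarrow> real \<Rightarrow> real" where
  "alpha p q = 1 - gf (diffs p) q"

definition gam :: "(nat \<Rightarrow> real) \<Rightarrow> real \<Rightarrow> real \<Rightarrow> real" where
  "gam p q r = alpha p q / (gf (diffs p) r - 1)"

definition psi :: "(nat \<Rightarrow> real) \<Rightarrow> real \<Rightarrow> real \<Rightarrow> real \<Rightarrow> real" where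
  "psi p q r x =
     (tail_gf p [q, q, r, x] - gam p q r * tail_gf p [q, r, r, x]) / tail_gf p [q, r, x]"

definition m2 :: "(nat \<Rightarrow> real) \<Rightarrow> real" where
  "m2 p = gf (diffs (diffs p)) 1 / 2"

definition m3 :: "(nat \<Rightarrow> real) \<Rightarrow> real" where
  "m3 p = gf (diffs (diffs (diffs p))) 1 / 6"

definition f3 :: "(nat \<Rightarrow> real) \<Rightarrow> real \<Rightarrow> real" where
  "f3 p x = (gf p x - x) / (1 - x)\<^sup>2"

definition f4 :: "(nat \<Rightarrow> real) \<Rightarrow> real \<Rightarrow> real" where
  "f4 p x = (m2 p - f3 p x) / (1 - x)"

definition f5 :: "(nat \<Rightarrow> real) \<Rightarrow> real \<Rightarrow> real" where
  "f5 p x = (m3 p - f4 p x) / (1 - x)"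

definition psi_crit :: "(nat \<Rightarrow> real) \<Rightarrow> real \<Rightarrow> real" where
  "psi_crit p x = (f4 p x)\<^sup>2 / ((m2 p)\<^sup>2 * f3 p x) - f5 p x / (m2 p)\<^sup>2"


section \<open>Modified linear-fractional generating functions\<close>

text \<open>The condition \<open>b * s < 1\<close> expresses \<open>s < 1 / b\<close>, with \<open>1 / b = \<infinity>\<close> when \<open>b = 0\<close>.\<close>

definition mlf_form :: "(nat \<Rightarrow> real) \<Rightarrow> real \<Rightarrow> real \<Rightarrow> real \<Rightarrow> real \<Rightarrow> bool" where
  "mlf_form p p0 p1 p\<Delta> b \<longleftrightarrow>
     p0 \<in> {0..<1} \<and> p1 \<in> {0..<1} \<and> p\<Delta> \<in> {0..<1} \<and> b \<in> {0..<1} \<and> p0 + p1 + p\<Delta> < 1 \<and>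
     (\<forall>s\<ge>0. b * s < 1 \<longrightarrow>
        (\<lambda>k. p k * s ^ k) sums
          (p0 + p1 * s + (1 - p0 - p1 - p\<Delta>) * s\<^sup>2 * (1 - b) * inverse (1 - b * s)))"

definition modified_linear_fractional :: "(nat \<Rightarrow> real) \<Rightarrow> bool" where
  "modified_linear_fractional p \<longleftrightarrow> (\<exists>p0 p1 p\<Delta> b. mlf_form p p0 p1 p\<Delta> b)"


section \<open>The continuous-time Markov branching process\<close>

text \<open>
  Particles carry Ulam--Harris labels: the ancestor is \<open>[]\<close>, and the \<open>i\<close>-th child of \<open>u\<close>
  (counting from 0) is \<open>i # u\<close>. Every potential particle \<open>u\<close> has a life length \<open>L u\<close> and an
  outcome \<open>N u\<close> at its death: \<open>Some k\<close> means that it is replaced by \<open>k\<close> particles, \<open>None\<close>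
  that it sends the whole process to the graveyard. The second and last assumptions together
  make all the variables \<open>L u\<close>, \<open>N u\<close> mutually independent; the last one is not phrased with
  \<^term>\<open>prob_space.indep_var\<close> because that constant requires variables with values of the same
  type.
\<close>

locale branching_particles = prob_space M
  for M :: "'a measure" and p :: "nat \<Rightarrow> real"
    and L :: "nat list \<Rightarrow> 'a \<Rightarrow> real" and N :: "nat list \<Rightarrow> 'a \<Rightarrow> nat option" +
  assumes life_length: "\<And>u. distributed M lborel (L u) (exponential_density 1)"
    and indep_particles:
      "indep_vars (\<lambda>_. borel \<Otimes>\<^sub>M count_space UNIV) (\<lambda>u \<omega>. (L u \<omega>, N u \<omega>)) UNIV"
    and offspring_number: "\<And>u k. prob {\<omega> \<in> space M. N u \<omega> = Some k} = p k"
    and graveyard: "\<And>u. prob {\<omega> \<in> space M. N u \<omega> = None} = 1 - (\<Sum>k. p k)"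
    and indep_life_offspring:
      "\<And>u. distr M (borel \<Otimes>\<^sub>M count_space UNIV) (\<lambda>\<omega>. (L u \<omega>, N u \<omega>)) =
             distr M borel (L u) \<Otimes>\<^sub>M distr M (count_space UNIV) (N u)"

text \<open>Every offspring law admits such a family of variables.\<close>

lemma branching_particles_exist:
  assumes "offspring_law p"
  shows "\<exists>(M :: (nat list \<Rightarrow> real \<times> nat option) measure) L N. branching_particles M p L N"
proof -
  define h where "h = (\<lambda>z. case z of None \<Rightarrow> 1 - (\<Sum>k. p k) | Some k \<Rightarrow> p k)"
  have p: "\<And>k. 0 \<le> p k" "summable p" "(\<Sum>k. p k) \<le> 1"
    using assms by (auto simp: offspring_law_def)
  have h_nonneg: "0 \<le> h z" for z
    using p by (auto simp: h_def split: option.split)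
  have "(\<integral>\<^sup>+ z. ennreal (h z) \<partial>count_space UNIV) =
      (\<integral>\<^sup>+ z. ennreal (h z) * indicator {None} z + ennreal (h z) * indicator (range Some) z \<partial>count_space UNIV)"
    proof (rule nn_integral_cong, goal_cases)
    case (1 z) then show ?case by (cases z) (auto simp: indicator_def)
  qed
  also have "\<dots> = ennreal (h None) + (\<integral>\<^sup>+ z. ennreal (h z) \<partial>count_space (range Some))"
    by (subst nn_integral_add) (auto simp: nn_integral_count_space_indicator)
  also have "(\<integral>\<^sup>+ z. ennreal (h z) \<partial>count_space (range Some)) = (\<integral>\<^sup>+ k. ennreal (h (Some k)) \<partial>count_space UNIV)"
    by (subst nn_integral_bij_count_space[of Some UNIV, symmetric]) (auto intro!: inj_on_imp_bij_betw)
  also have "\<dots> = ennreal (\<Sum>k. p k)"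
    using p by (simp add: h_def nn_integral_count_space_nat suminf_ennreal2)
  also have "ennreal (h None) + ennreal (\<Sum>k. p k) = 1"
    using p by (simp add: h_def ennreal_plus[symmetric] suminf_nonneg del: ennreal_plus)
  finally have h_sum: "(\<integral>\<^sup>+ z. ennreal (h z) \<partial>count_space UNIV) = 1" .
  define K where "K = measure_pmf (embed_pmf h)"
  define E :: "real measure" where "E = density lborel (exponential_density 1)"
  interpret K: prob_space K unfolding K_def by (rule measure_pmf.prob_space_axioms)
  interpret E: prob_space E unfolding E_def by (rule prob_space_exponential_density) simp
  interpret EO: pair_prob_space E K ..
  have [measurable_cong, simp]: "sets K = sets (count_space UNIV)" "sets E = sets borel"
    by (auto simp: K_def E_def)
  have sEO: "sets (E \<Otimes>\<^sub>M K) = sets (borel \<Otimes>\<^sub>M count_space UNIV)"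
    by (intro sets_pair_measure_cong) auto
  define P where "P = (\<Pi>\<^sub>M u\<in>(UNIV :: nat list set). E \<Otimes>\<^sub>M K)"
  have comp: "distr P (E \<Otimes>\<^sub>M K) (\<lambda>\<omega>. \<omega> u) = E \<Otimes>\<^sub>M K" for u
    unfolding P_def by (rule distr_PiM_component) (auto intro: EO.prob_space_axioms)
  have [measurable]: "(\<lambda>\<omega>. \<omega> u) \<in> P \<rightarrow>\<^sub>M E \<Otimes>\<^sub>M K" for u
    unfolding P_def by simp
  have dE: "distr P E (\<lambda>\<omega>. fst (\<omega> u)) = E" for u
  proof -
    have "distr P E (\<lambda>\<omega>. fst (\<omega> u)) = distr (distr P (E \<Otimes>\<^sub>M K) (\<lambda>\<omega>. \<omega> u)) E fst"
      by (subst distr_distr) (auto simp: o_def)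
    also have "\<dots> = E" unfolding comp by (rule K.distr_pair_fst)
    finally show ?thesis .
  qed
  have dO: "distr P K (\<lambda>\<omega>. snd (\<omega> u)) = K" for u
  proof -
    have "distr P K (\<lambda>\<omega>. snd (\<omega> u)) = distr (distr P (E \<Otimes>\<^sub>M K) (\<lambda>\<omega>. \<omega> u)) K snd"
      by (subst distr_distr) (auto simp: o_def)
    also have "\<dots> = K" unfolding comp 
    proof (rule measure_eqI)
      fix A assume "A \<in> sets (distr (E \<Otimes>\<^sub>M K) K snd)"
      then have A: "A \<in> sets K" by simp
      have "snd -` A \<inter> space (E \<Otimes>\<^sub>M K) = space E \<times> A"
        using sets.sets_into_space[OF A] by (auto simp: space_pair_measure)
      then show "emeasure (distr (E \<Otimes>\<^sub>M K) K snd) A = emeasure K A"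
        using A K.emeasure_pair_measure_Times[OF sets.top A, of E]
        by (simp add: emeasure_distr E.emeasure_space_1)
    qed simp
    finally show ?thesis .
  qed
  interpret P: prob_space P
    unfolding P_def by (rule prob_space_PiM) (rule EO.prob_space_axioms)
  have off: "P.prob {\<omega> \<in> space P. snd (\<omega> u) = z} = h z" for u z
  proof -
    have "P.prob {\<omega> \<in> space P. snd (\<omega> u) = z} = measure (distr P K (\<lambda>\<omega>. snd (\<omega> u))) {z}"
      by (subst measure_distr) (auto intro!: arg_cong[where f = P.prob])
    also have "\<dots> = measure (measure_pmf (embed_pmf h)) {z}"
      by (simp only: dO) (simp add: K_def)
    also have "\<dots> = h z"
      using pmf_embed_pmf[of h z, OF h_nonneg h_sum] by (simp add: pmf.rep_eq)
    finally show ?thesis .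
  qed
  have "branching_particles P p (\<lambda>u \<omega>. fst (\<omega> u)) (\<lambda>u \<omega>. snd (\<omega> u))"
  proof
    fix u :: "nat list" and k
    have "distr P lborel (\<lambda>\<omega>. fst (\<omega> u)) = E"
      by (subst dE[of u, symmetric], rule distr_cong) auto
    moreover have "(\<lambda>\<omega>. fst (\<omega> u)) \<in> P \<rightarrow>\<^sub>M E" for u by measurable
    then have "(\<lambda>\<omega>. fst (\<omega> u)) \<in> P \<rightarrow>\<^sub>M borel"
      by (simp add: E_def)
    ultimately show "distributed P lborel (\<lambda>\<omega>. fst (\<omega> u)) (exponential_density 1)"
      by (auto simp: distributed_def E_def)
    show "P.prob {\<omega> \<in> space P. snd (\<omega> u) = Some k} = p k"
      "P.prob {\<omega> \<in> space P. snd (\<omega> u) = None} = 1 - (\<Sum>k. p k)"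
      by (simp_all only: off) (simp_all add: h_def)
    have a: "distr P borel (\<lambda>\<omega>. fst (\<omega> u)) = E"
      by (subst dE[of u, symmetric], rule distr_cong) auto
    have b: "distr P (count_space UNIV) (\<lambda>\<omega>. snd (\<omega> u)) = K"
      by (subst dO[of u, symmetric], rule distr_cong) auto
    have "distr P (borel \<Otimes>\<^sub>M count_space UNIV) (\<lambda>\<omega>. \<omega> u) = E \<Otimes>\<^sub>M K"
      by (subst comp[of u, symmetric], rule distr_cong) (auto simp: sEO)
    then show "distr P (borel \<Otimes>\<^sub>M count_space UNIV) (\<lambda>\<omega>. (fst (\<omega> u), snd (\<omega> u))) =
       distr P borel (\<lambda>\<omega>. fst (\<omega> u)) \<Otimes>\<^sub>M distr P (count_space UNIV) (\<lambda>\<omega>. snd (\<omega> u))"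
      by (simp add: a b)
  next
    have c: "distr P (borel \<Otimes>\<^sub>M count_space UNIV) (\<lambda>\<omega>. \<omega> u) = E \<Otimes>\<^sub>M K" for u
      by (subst comp[of u, symmetric], rule distr_cong) (auto simp: sEO)
    have m: "(\<lambda>\<omega>. \<omega> u) \<in> P \<rightarrow>\<^sub>M borel \<Otimes>\<^sub>M count_space UNIV" for u
      by (subst measurable_cong_sets[OF refl sEO[symmetric]]) simp
    have sP: "sets (\<Pi>\<^sub>M i\<in>UNIV. borel \<Otimes>\<^sub>M count_space UNIV) = sets P"
      unfolding P_def by (intro sets_PiM_cong) (auto simp: sEO)
    have "distr P (\<Pi>\<^sub>M i\<in>UNIV. borel \<Otimes>\<^sub>M count_space UNIV) (\<lambda>\<omega>. \<omega>) = distr P P (\<lambda>\<omega>. \<omega>)"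
      by (rule distr_cong) (auto simp: sP)
    then have "P.indep_vars (\<lambda>_. borel \<Otimes>\<^sub>M count_space UNIV) (\<lambda>u \<omega>. \<omega> u) UNIV"
      using m by (subst P.indep_vars_iff_distr_eq_PiM') (simp_all add: c restrict_UNIV P_def[symmetric])
    then show "P.indep_vars (\<lambda>_. borel \<Otimes>\<^sub>M count_space UNIV) (\<lambda>u \<omega>. (fst (\<omega> u), snd (\<omega> u))) UNIV"
      by simp
  qed
  then show ?thesis by blast
qed

primrec realised :: "(nat list \<Rightarrow> 'a \<Rightarrow> nat option) \<Rightarrow> 'a \<Rightarrow> nat list \<Rightarrow> bool" where
  "realised N \<omega> [] \<longleftrightarrow> True"
| "realised N \<omega> (i # u) \<longleftrightarrow> realised N \<omega> u \<and> (\<exists>k. N u \<omega> = Some k \<and> i < k)"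

primrec birth_time :: "(nat list \<Rightarrow> 'a \<Rightarrow> real) \<Rightarrow> 'a \<Rightarrow> nat list \<Rightarrow> real" where
  "birth_time L \<omega> [] = 0"
| "birth_time L \<omega> (i # u) = birth_time L \<omega> u + L u \<omega>"

definition death_time :: "(nat list \<Rightarrow> 'a \<Rightarrow> real) \<Rightarrow> 'a \<Rightarrow> nat list \<Rightarrow> real" where
  "death_time L \<omega> u = birth_time L \<omega> u + L u \<omega>"

definition alive ::
  "(nat list \<Rightarrow> 'a \<Rightarrow> real) \<Rightarrow> (nat list \<Rightarrow> 'a \<Rightarrow> nat option) \<Rightarrow> real \<Rightarrow> 'a \<Rightarrow> nat list set" where
  "alive L N t \<omega> = {u. realised N \<omega> u \<and> birth_time L \<omega> u \<le> t \<and> t < death_time L \<omega> u}"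

definition killed ::
  "(nat list \<Rightarrow> 'a \<Rightarrow> real) \<Rightarrow> (nat list \<Rightarrow> 'a \<Rightarrow> nat option) \<Rightarrow> real \<Rightarrow> 'a \<Rightarrow> bool" where
  "killed L N t \<omega> \<longleftrightarrow> (\<exists>u. realised N \<omega> u \<and> N u \<omega> = None \<and> death_time L \<omega> u \<le> t)"

definition exploded ::
  "(nat list \<Rightarrow> 'a \<Rightarrow> real) \<Rightarrow> (nat list \<Rightarrow> 'a \<Rightarrow> nat option) \<Rightarrow> real \<Rightarrow> 'a \<Rightarrow> bool" where
  "exploded L N t \<omega> \<longleftrightarrow> infinite {u. realised N \<omega> u \<and> birth_time L \<omega> u \<le> t}"

text \<open>
  The number of particles at time \<open>t\<close>, with \<open>None\<close> for the graveyard. After an explosion, which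
  has probability zero whenever \<open>f'(1) < \<infinity>\<close>, there is no finite population size and the value is
  \<open>None\<close> as well.
\<close>

definition population ::
  "(nat list \<Rightarrow> 'a \<Rightarrow> real) \<Rightarrow> (nat list \<Rightarrow> 'a \<Rightarrow> nat option) \<Rightarrow> real \<Rightarrow> 'a \<Rightarrow> nat option" where
  "population L N t \<omega> =
     (if killed L N t \<omega> \<or> exploded L N t \<omega> then None else Some (card (alive L N t \<omega>)))"

text \<open>The power \<open>s ^ z\<close> with the convention \<open>s\<^sup>\<Delta> = 0\<close>.\<close>

definition gpow :: "real \<Rightarrow> nat option \<Rightarrow> real" where
  "gpow s z = (case z of None \<Rightarrow> 0 | Some k \<Rightarrow> s ^ k)"

definition process_gf ::
  "'a measure \<Rightarrow> (nat list \<Rightarrow> 'a \<Rightarrow> real) \<Rightarrow> (nat list \<Rightarrow> 'a \<Rightarrow> nat option) \<Rightarrow> real \<Rightarrow> real \<Rightarrow> real"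
  where
  "process_gf M L N t s = (\<integral>\<omega>. gpow s (population L N t \<omega>) \<partial>M)"

end

(* With g(x) = f^(3)(q,r,x), both fourth-order tail functions are divided differences of g, and
   gamma = g(q)/g(r). Hence psi = 0 says that g(x) ((r-x) + gamma (x-q)) is constant, i.e. that g is
   linear-fractional, and f(x) = x - (x-q)(r-x) g(x) then has a geometric tail. In the critical case
   psi = 0 likewise reduces to f_3(x) (m_2 + m_3 (1-x)) = m_2^2.

   For the process, conditioning on the first death gives F_t = s e^(-t) + int_0^t e^(-l) f(F_(t-l)) dl,
   first for the tree cut off at a finite height, so that F is the minimal solution; in particular
   F <= r and F' = f(F) - F. Since F - q and r - F satisfy linear equations with coefficients
   -(r-F) g(F) and (F-q) g(F), both are explicit exponentials of integrals, and the identity for g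
   makes the combination of the two integrals equal to alpha t. *)

theory Submission
  imports Defs
begin

section \<open>Power series\<close>

text \<open>Tail functions are handled through their coefficients in the last variable:
  \<open>tail_coeff a\<close> sends the coefficients of v(x) to those of (v(a) - v(x)) / (a - x),
  and iterating it over a list of points produces every order. At a repeated point the quotient
  becomes 0/0 and the value is a derivative. This is delicate at r, which may be the boundary of
  convergence, and there finiteness of f'(r) enters. The geometric ratio is (1 - gamma) / (r - gamma
  q), respectively m_3 / (m_2 + m_3). In the first case it is nonnegative because g is
  nondecreasing, so that gamma <= 1. For the process, the tree may a priori be infinite and s may
  exceed 1, so neither a recursion over the tree nor finiteness of the expectation is immediate. The
  cut at a finite height provides both: exploding trees are cut at every height and contribute 0, in
  accordance with the value \<open>None\<close> of the population. Solving linear equations by an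
  integrating factor avoids logarithms of F - q, whose sign depends on s.\<close>

lemma power_series_zero_imp_head_zero:
  fixes a :: "nat \<Rightarrow> real"
  assumes "0 < d" and "\<And>x. 0 < x \<Longrightarrow> x < d \<Longrightarrow> (\<lambda>k. a k * x ^ k) sums 0"
  shows "a 0 = 0"
proof -
  have sm: "summable (\<lambda>k. a k * x ^ k)" if "norm x < d / 2" for x
    by (rule powser_inside[of _ "d / 2"]) (use that assms(1) assms(2)[of "d / 2"] in \<open>auto simp: sums_iff\<close>)
  have "(gf a \<longlongrightarrow> a 0) (at 0)"
    by (rule powser_limit_0[of "d / 2"])
      (use assms(1) sm in \<open>auto simp: gf_def intro!: summable_sums\<close>)
  then have "(gf a \<longlongrightarrow> a 0) (at_right 0)"
    by (rule tendsto_within_subset) simp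
  moreover have "\<forall>\<^sub>F x in at_right 0. gf a x = 0"
    unfolding eventually_at_right_field using assms by (auto simp: gf_def sums_iff)
  then have "(gf a \<longlongrightarrow> 0) (at_right 0)"
    by (rule tendsto_eventually)
  ultimately show ?thesis
    using tendsto_unique trivial_limit_at_right_real by blast
qed

text \<open>Once the head vanishes, division by x passes the hypothesis on to the shifted sequence.
  Arguments to the right of 0 suffice, which matters because the identities compared later are given
  on (0, 1) only.\<close>

lemma power_series_zero_imp_coeff_zero:
  fixes a :: "nat \<Rightarrow> real"
  assumes "0 < d" and "\<And>x. 0 < x \<Longrightarrow> x < d \<Longrightarrow> (\<lambda>k. a k * x ^ k) sums 0"
  shows "a k = 0"
  using assms(2)
proof (induction k arbitrary: a)
  case 0
  show ?case by (rule power_series_zero_imp_head_zero[OF assms(1) 0])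
next
  case (Suc k)
  have a0: "a 0 = 0"
    by (rule power_series_zero_imp_head_zero[OF assms(1) Suc.prems])
  have "(\<lambda>k. a (Suc k) * x ^ k) sums 0" if "0 < x" "x < d" for x
  proof -
    have "(\<lambda>k. a (Suc k) * x ^ Suc k) sums 0"
      using Suc.prems[OF that] a0 by (subst sums_Suc_iff) simp
    then have "(\<lambda>k. (a (Suc k) * x ^ Suc k) / x) sums (0 / x)"
      by (rule sums_divide)
    then show ?thesis using that by simp
  qed
  then show ?case by (rule Suc.IH)
qed

lemma geometric_tail_sums:
  fixes p :: "nat \<Rightarrow> real"
  assumes "\<And>k. p (Suc (Suc k)) = c * b ^ k" and "\<bar>b * x\<bar> < 1"
  shows "(\<lambda>k. p k * x ^ k) sums (p 0 + p 1 * x + c * x\<^sup>2 / (1 - b * x))"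
proof -
  have "(\<lambda>k. c * x\<^sup>2 * (b * x) ^ k) sums (c * x\<^sup>2 * (1 / (1 - b * x)))"
    by (intro sums_mult geometric_sums) (use assms(2) in auto)
  moreover have "c * x\<^sup>2 * (b * x) ^ k = p (Suc (Suc k)) * x ^ Suc (Suc k)" for k
    unfolding assms(1) power_mult_distrib by (simp add: power2_eq_square)
  ultimately have "(\<lambda>k. p (Suc (Suc k)) * x ^ Suc (Suc k)) sums (c * x\<^sup>2 / (1 - b * x))"
    by simp
  from sums_Suc[OF sums_Suc[OF this]] show ?thesis
    by (simp add: add_ac)
qed

lemma geometric_tail_diffs_sums:
  fixes p :: "nat \<Rightarrow> real"
  assumes "\<And>k. p (Suc (Suc k)) = c * b ^ k" and "\<bar>b * x\<bar> < 1"
  shows "(\<lambda>k. diffs p k * x ^ k) sums (p 1 + c * x * (1 / (1 - b * x)\<^sup>2 + 1 / (1 - b * x)))"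
proof -
  have "(\<lambda>k. c * x * (of_nat (Suc k) * (b * x) ^ k + (b * x) ^ k)) sums
      (c * x * (1 / (1 - b * x)\<^sup>2 + 1 / (1 - b * x)))"
    by (intro sums_mult sums_add geometric_sums geometric_deriv_sums) (use assms(2) in auto)
  moreover have "c * x * (of_nat (Suc k) * (b * x) ^ k + (b * x) ^ k) = diffs p (Suc k) * x ^ Suc k" for k
    unfolding diffs_def assms(1) power_mult_distrib by (simp add: algebra_simps)
  ultimately have "(\<lambda>k. diffs p (Suc k) * x ^ Suc k) sums
      (c * x * (1 / (1 - b * x)\<^sup>2 + 1 / (1 - b * x)))"
    by (simp only:)
  from sums_Suc[OF this] show ?thesis
    by (simp add: diffs_def add_ac)
qed

text \<open>Summing the recurrence gives U = b * U + W for the sum U of u. This evaluates f''(1) and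
  f'''(1) for a geometric tail: each termwise derivative obeys such a recurrence, driven by a series
  already summed.\<close>

lemma sums_of_geometric_recurrence:
  fixes u w :: "nat \<Rightarrow> real"
  assumes "summable u" "w sums W" "u 0 = w 0" "\<And>k. u (Suc k) = b * u k + w (Suc k)" "b \<noteq> 1"
  shows "u sums (W / (1 - b))"
proof -
  obtain U where U: "u sums U" using assms(1) by (auto simp: summable_def)
  have "(\<lambda>k. w (Suc k)) sums (W - w 0)"
    using assms(2) by (subst sums_Suc_iff) simp
  then have "(\<lambda>k. b * u k + w (Suc k)) sums (b * U + (W - w 0))"
    by (intro sums_add sums_mult U)
  then have "(\<lambda>k. u (Suc k)) sums (b * U + (W - w 0))"
    by (simp only: assms(4))
  then have "u sums (b * U + (W - w 0) + u 0)"
    by (rule sums_Suc)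
  from sums_unique2[OF U this] have "U = b * U + W"
    using assms(3) by simp
  then have "U = W / (1 - b)"
    using assms(5) by (simp add: field_simps)
  with U show ?thesis by simp
qed


section \<open>Modified linear-fractional laws\<close>

text \<open>Uniqueness of power series coefficients turns the closed form of f into a geometric tail
  from index 2 on, the shape in which the form is used from here on.\<close>

lemma mlf_form_coeffs:
  assumes "mlf_form p p0 p1 pd b"
  defines "c \<equiv> (1 - p0 - p1 - pd) * (1 - b)"
  shows "p 0 = p0" "p 1 = p1" "\<And>k. p (Suc (Suc k)) = c * b ^ k" "0 < c" "0 \<le> b" "b < 1"
proof -
  show b: "0 \<le> b" "b < 1" and "0 < c"
    using assms(1) by (auto simp: mlf_form_def c_def)
  define e where "e k = (if k = 0 then p0 else if k = 1 then p1 else c * b ^ (k - 2))" for k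
  have "p k - e k = 0" for k
  proof (rule power_series_zero_imp_coeff_zero[where d = 1 and a = "\<lambda>k. p k - e k"])
    fix x :: real assume x: "0 < x" "x < 1"
    have "b * x \<le> 1 * x"
      by (rule mult_right_mono) (use b x in auto)
    with x have "b * x < 1" by linarith
    moreover have "0 \<le> b * x" using b x by simp
    ultimately have bx: "b * x < 1" "0 \<le> b * x" .
    have ek: "(\<lambda>k. e k * x ^ k) sums (e 0 + e 1 * x + c * x\<^sup>2 / (1 - b * x))"
      by (rule geometric_tail_sums[where b = b]) (use bx in \<open>auto simp: e_def\<close>)
    have all: "\<forall>s\<ge>0. b * s < 1 \<longrightarrow> (\<lambda>k. p k * s ^ k) sums
          (p0 + p1 * s + (1 - p0 - p1 - pd) * s\<^sup>2 * (1 - b) * inverse (1 - b * s))"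
      using assms(1) unfolding mlf_form_def by (elim conjE)
    have pk: "(\<lambda>k. p k * x ^ k) sums (p0 + p1 * x + c * x\<^sup>2 / (1 - b * x))"
    proof -
      have "(\<lambda>k. p k * x ^ k) sums
          (p0 + p1 * x + (1 - p0 - p1 - pd) * x\<^sup>2 * (1 - b) * inverse (1 - b * x))"
        by (rule all[rule_format]) (use x bx in auto)
      moreover have "(1 - p0 - p1 - pd) * x\<^sup>2 * (1 - b) * inverse (1 - b * x) = c * x\<^sup>2 / (1 - b * x)"
        by (simp add: c_def divide_inverse)
      ultimately show ?thesis by simp
    qed
    have "(\<lambda>k. p k * x ^ k - e k * x ^ k) sums 0"
      using sums_diff[OF pk ek] by (simp add: e_def)
    then show "(\<lambda>k. (p k - e k) * x ^ k) sums 0" by (simp add: algebra_simps)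
  qed simp
  then have "p k = e k" for k by simp
  then show "p 0 = p0" "p 1 = p1" "\<And>k. p (Suc (Suc k)) = c * b ^ k" by (auto simp: e_def)
qed

lemma mlf_coeffsE:
  assumes "modified_linear_fractional p"
  obtains c b where "\<And>k. p (Suc (Suc k)) = c * b ^ k" "0 < c" "0 \<le> b" "b < 1"
proof -
  from assms obtain p0 p1 pd b where m: "mlf_form p p0 p1 pd b"
    unfolding modified_linear_fractional_def by blast
  show ?thesis
    by (rule that[of "(1 - p0 - p1 - pd) * (1 - b)" b]) (rule mlf_form_coeffs[OF m])+
qed

lemma mlfI_coeffs:
  assumes "offspring_law p" "\<And>k. p (Suc (Suc k)) = c * b ^ k" "0 < c" "0 \<le> b" "b < 1"
  shows "modified_linear_fractional p"
proof -
  have "p sums (p 0 + p 1 + c / (1 - b))"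
    using geometric_tail_sums[of p c b 1] assms by simp
  then have S: "(\<Sum>k. p k) = p 0 + p 1 + c / (1 - b)" by (simp add: sums_iff)
  \<comment> \<open>The defect of the law. With it, the mass 1 - p0 - p1 - pd left over for the tail
    is the total c / (1 - b) of the geometric part.\<close>
  define pd where "pd = 1 - (\<Sum>k. p k)"
  have pos: "c / (1 - b) > 0" using assms by simp
  have pd: "1 - p 0 - p 1 - pd = c / (1 - b)" by (simp add: pd_def S)
  have nn: "p 0 \<ge> 0" "p 1 \<ge> 0" "pd \<ge> 0" using assms(1) by (auto simp: offspring_law_def pd_def)
  have "mlf_form p (p 0) (p 1) pd b"
    unfolding mlf_form_def
  proof (intro conjI allI impI)
    fix s :: real assume s: "0 \<le> s" "b * s < 1"
    then have "\<bar>b * s\<bar> < 1" using assms(4) by simp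
    moreover have c: "(1 - p 0 - p 1 - pd) * s\<^sup>2 * (1 - b) * inverse (1 - b * s) = c * s\<^sup>2 / (1 - b * s)"
      using assms(5) unfolding pd by (simp add: divide_inverse)
    ultimately show "(\<lambda>k. p k * s ^ k) sums
      (p 0 + p 1 * s + (1 - p 0 - p 1 - pd) * s\<^sup>2 * (1 - b) * inverse (1 - b * s))"
      using geometric_tail_sums[OF assms(2)] by (simp only: c)
  next
    show "p 0 + p 1 + pd < 1" using pos pd by linarith
    then show "p 0 \<in> {0..<1}" "p 1 \<in> {0..<1}" "pd \<in> {0..<1}" using nn by auto
  qed (use assms in auto)
  then show ?thesis unfolding modified_linear_fractional_def by blast
qed

text \<open>Since f(x) * (A - B * x) is quadratic, A * p k = B * p (k - 1) from k = 3 on, a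
  geometric tail of ratio B / A < 1. The given k >= 2 with p k \<noteq> 0 keeps this tail from being
  identically zero, as required by \<open>mlf_form\<close>. Both cases end here.\<close>

lemma mlfI_rational:
  assumes p: "offspring_law p" and k: "k \<ge> 2" "p k \<noteq> 0" and AB: "0 \<le> B" "B < A"
    and rat: "\<And>x. 0 < x \<Longrightarrow> x < 1 \<Longrightarrow> gf p x * (A - B * x) = a0 + a1 * x + a2 * x\<^sup>2"
  shows "modified_linear_fractional p"
proof -
  define e where "e k = A * p k - (if k = 0 then 0 else B * p (k - 1)) -
    (if k = 0 then a0 else if k = 1 then a1 else if k = 2 then a2 else 0)" for k
  have "e k = 0" for k
  proof (rule power_series_zero_imp_coeff_zero[where d = 1 and a = e])
    fix x :: real assume x: "0 < x" "x < 1"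
    have "summable (\<lambda>k. p k * x ^ k)"
      by (rule powser_inside[of _ 1]) (use x p in \<open>auto simp: offspring_law_def\<close>)
    then have s: "(\<lambda>k. p k * x ^ k) sums gf p x" by (simp add: gf_def summable_sums)
    from sums_mult[OF this, of "B * x"]
    have "(\<lambda>k. (if Suc k = 0 then 0 else B * p (Suc k - 1)) * x ^ Suc k) sums (B * x * gf p x)"
      by (simp add: mult_ac)
    then have s2: "(\<lambda>k. (if k = 0 then 0 else B * p (k - 1)) * x ^ k) sums (B * x * gf p x)"
      by (subst (asm) sums_Suc_iff) simp
    have "(\<lambda>k. (if k = 0 then a0 else if k = 1 then a1 else if k = 2 then a2 else 0) * x ^ k) sums
       (\<Sum>k\<in>{0,1,2}. (if k = 0 then a0 else if k = 1 then a1 else if k = 2 then a2 else 0) * x ^ k)"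
      by (rule sums_finite) auto
    from sums_diff[OF sums_diff[OF sums_mult[OF s, of A] s2] this]
    have "(\<lambda>k. e k * x ^ k) sums (A * gf p x - B * x * gf p x - (a0 + a1 * x + a2 * x\<^sup>2))"
      by (simp add: e_def algebra_simps)
    then show "(\<lambda>k. e k * x ^ k) sums 0"
      using rat[OF x] by (simp add: algebra_simps)
  qed simp
  note e0 = this
  have rec: "p (Suc (Suc (Suc k))) = B / A * p (Suc (Suc k))" for k
    using e0[of "Suc (Suc (Suc k))"] AB by (simp add: e_def field_simps numeral_2_eq_2)
  have geo: "p (Suc (Suc k)) = p 2 * (B / A) ^ k" for k
    by (induction k) (simp_all add: rec numeral_2_eq_2)
  obtain j where "k = Suc (Suc j)"
    using k(1) by (metis Suc_le_D numeral_2_eq_2 Suc_le_mono)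
  then have "p 2 \<noteq> 0" using k(2) geo[of j] by auto
  moreover have "p 2 \<ge> 0" using p by (auto simp: offspring_law_def)
  ultimately show ?thesis
    by (intro mlfI_coeffs[OF p geo]) (use AB in auto)
qed

section \<open>The critical case\<close>

text \<open>The tangent of x^n at 1 lies strictly below the curve as soon as n >= 2; a single
  offspring number of this size then gives f(x) > x in the critical case.\<close>

lemma strict_Bernoulli:
  fixes x :: real
  assumes "0 \<le> x" "x < 1"
  shows "1 + real (Suc (Suc k)) * (x - 1) < x ^ Suc (Suc k)"
proof (induction k)
  case 0
  have "0 < (x - 1)\<^sup>2" using assms by simp
  then show ?case by (simp add: power2_eq_square algebra_simps)
next
  case (Suc k)
  have "x * (1 + real (Suc (Suc k)) * (x - 1)) \<le> x * x ^ Suc (Suc k)"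
    by (rule mult_left_mono) (use Suc assms in auto)
  moreover have "0 < (real k + 2) * (x - 1)\<^sup>2" using assms by simp
  ultimately show ?case by (simp add: power2_eq_square algebra_simps)
qed

lemma summable_if_summable_diffs:
  fixes v :: "nat \<Rightarrow> real"
  assumes "\<And>k. 0 \<le> v k" "summable (diffs v)"
  shows "summable v"
proof (subst summable_Suc_iff[symmetric], rule summable_comparison_test'[OF assms(2)])
  fix k :: nat
  show "norm (v (Suc k)) \<le> diffs v k"
    using assms(1)[of "Suc k"] by (simp add: diffs_def mult_le_cancel_right1)
qed

lemma critical_facts:
  assumes "offspring_law p" "critical p"
  shows "\<exists>k\<ge>2. p k \<noteq> 0" and "0 < m2 p" and "0 \<le> m3 p"
    and "\<And>x. 0 \<le> x \<Longrightarrow> x < 1 \<Longrightarrow> 0 < f3 p x"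
proof -
  have p: "\<And>k. 0 \<le> p k" "p 1 \<noteq> 1" using assms(1) by (auto simp: offspring_law_def)
  have s: "p sums 1" "diffs p sums 1" and s3: "summable (diffs (diffs (diffs p)))"
    using assms(2) by (auto simp: critical_def)
  show ex: "\<exists>k\<ge>2. p k \<noteq> 0"
  proof (rule ccontr)
    assume "\<not> ?thesis"
    \<comment> \<open>Without offspring numbers above 1, f'(1) would be p 1, which differs from
      1.\<close>
    then have "diffs p k = 0" if "k \<notin> {0}" for k using that by (auto simp: diffs_def)
    then have "diffs p sums (\<Sum>k\<in>{0}. diffs p k)" by (intro sums_finite) auto
    then have "diffs p sums p 1" by (simp add: diffs_def)
    with s(2) p(2) show False using sums_unique2 by blast
  qed
  then obtain j where j: "j \<ge> 2" "p j > 0" using p(1) by (metis order_less_le)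
  have s2: "summable (diffs (diffs p))"
    by (rule summable_if_summable_diffs[OF _ s3]) (use p(1) in \<open>auto simp: diffs_def\<close>)
  obtain i where i: "j = Suc (Suc i)" using j(1) by (metis Suc_le_D numeral_2_eq_2 Suc_le_mono)
  have "diffs (diffs p) i > 0"
    using j i by (simp add: diffs_def)
  with suminf_pos2[OF s2 _ this] show "0 < m2 p"
    using p(1) by (simp add: m2_def gf_def diffs_def)
  have "0 \<le> (\<Sum>k. diffs (diffs (diffs p)) k)"
    by (rule suminf_nonneg[OF s3]) (use p(1) in \<open>auto simp: diffs_def\<close>)
  then show "0 \<le> m3 p"
    by (simp add: m3_def gf_def)
  fix x :: real assume x: "0 \<le> x" "x < 1"
  have "summable (\<lambda>k. p k * x ^ k)"
    by (rule powser_inside[of _ 1]) (use x s in \<open>auto simp: sums_iff\<close>)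
  then have "(\<lambda>k. p k * x ^ k) sums gf p x" by (simp add: gf_def summable_sums)
  moreover have "(\<lambda>k. real k * p k) sums 1"
    using sums_Suc[of "\<lambda>k. real k * p k" 1] s(2) by (simp add: diffs_def)
  \<comment> \<open>As f(1) = f'(1) = 1, the line y = x is the tangent of f at 1, and f(x) - x
    splits into nonnegative Bernoulli gaps weighted by p k.\<close>
  ultimately have "(\<lambda>k. p k * x ^ k - p k - (x - 1) * (real k * p k)) sums (gf p x - 1 - (x - 1) * 1)"
    by (intro sums_diff sums_mult s)
  then have "(\<lambda>k. p k * (x ^ k - (1 + real k * (x - 1)))) sums (gf p x - x)"
    by (simp add: algebra_simps)
  moreover have "0 \<le> p k * (x ^ k - (1 + real k * (x - 1)))" for k
    using p(1)[of k] Bernoulli_inequality[of "x - 1" k] x by simp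
  moreover have "0 < p j * (x ^ j - (1 + real j * (x - 1)))"
    using strict_Bernoulli[OF x, of i] j i by simp
  ultimately have "0 < gf p x - x"
    using suminf_pos2[of "\<lambda>k. p k * (x ^ k - (1 + real k * (x - 1)))" j] by (auto simp: sums_iff)
  then show "0 < f3 p x" using x by (simp add: f3_def)
qed

lemma mlf_if_psi_crit_zero:
  assumes p: "offspring_law p" "critical p" and psi: "\<And>x. 0 \<le> x \<Longrightarrow> x < 1 \<Longrightarrow> psi_crit p x = 0"
  shows "modified_linear_fractional p"
proof -
  note facts = critical_facts[OF p]
  obtain k where k: "k \<ge> 2" "p k \<noteq> 0" using facts(1) by blast
  show ?thesis
  \<comment> \<open>The denominator is m2 + m3 * (1 - x), to which f3 turns out to be inversely
    proportional.\<close>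
  proof (rule mlfI_rational[OF p(1) k facts(3), of "m2 p + m3 p"])
    show "m3 p < m2 p + m3 p" using facts(2) by simp
    fix x :: real assume x: "0 < x" "x < 1"
    define u where "u = 1 - x"
    have u: "u > 0" using x by (simp add: u_def)
    have f3: "f3 p x > 0" using facts(4) x by simp
    have e4: "u * f4 p x = m2 p - f3 p x" and e5: "u * f5 p x = m3 p - f4 p x"
      using u by (simp_all add: f4_def f5_def u_def)
    have e3: "f3 p x * u\<^sup>2 = gf p x - x" using u by (simp add: f3_def u_def)
    have "(f4 p x)\<^sup>2 = f3 p x * f5 p x"
      using psi[of x] x facts(2) f3 by (simp add: psi_crit_def field_simps)
    then have "(u * f4 p x) * f4 p x = f3 p x * (u * f5 p x)"
      by (simp add: power2_eq_square algebra_simps)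
    \<comment> \<open>The products f3 * f4 on the two sides cancel, so the quadratic condition
      becomes linear; another factor u then eliminates f4.\<close>
    then have "m2 p * f4 p x = m3 p * f3 p x"
      unfolding e4 e5 by (simp add: algebra_simps)
    then have "m2 p * (u * f4 p x) = m3 p * u * f3 p x" by (simp add: algebra_simps)
    then have "f3 p x * (m2 p + m3 p * u) = (m2 p)\<^sup>2"
      unfolding e4 by (simp add: power2_eq_square algebra_simps)
    then have "(f3 p x * u\<^sup>2) * (m2 p + m3 p * u) = (m2 p)\<^sup>2 * u\<^sup>2"
      by (simp add: mult_ac)
    then show "gf p x * (m2 p + m3 p - m3 p * x) =
        (m2 p)\<^sup>2 + (m2 p + m3 p - 2 * (m2 p)\<^sup>2) * x + ((m2 p)\<^sup>2 - m3 p) * x\<^sup>2"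
      unfolding e3 by (simp add: u_def power2_eq_square algebra_simps)
  qed
qed

lemma critical_mlf_coeffs:
  assumes "offspring_law p" "critical p" "\<And>k. p (Suc (Suc k)) = c * b ^ k" "0 \<le> b" "b < 1"
  shows "c = p 0 * (1 - b)\<^sup>2" "p 1 = 1 - p 0 * (2 - b)" "m2 p = p 0 / (1 - b)" "m3 p = p 0 * b / (1 - b)\<^sup>2"
    "\<And>s. \<bar>b * s\<bar> < 1 \<Longrightarrow> gf p s = s + p 0 * (1 - s)\<^sup>2 / (1 - b * s)"
proof -
  have s: "p sums 1" "diffs p sums 1" and s3: "summable (diffs (diffs (diffs p)))"
    using assms(2) by (auto simp: critical_def)
  \<comment> \<open>The two criticality conditions f(1) = 1 and f'(1) = 1 leave only p 0 and b
    free.\<close>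
  have "1 = p 0 + p 1 + c / (1 - b)" "1 = p 1 + c * (1 / (1 - b)\<^sup>2 + 1 / (1 - b))"
    using sums_unique2[OF s(1)] sums_unique2[OF s(2)] geometric_tail_sums[OF assms(3), of 1]
      geometric_tail_diffs_sums[OF assms(3), of 1] assms(4,5) by auto
  then have 0: "p 0 = c / (1 - b)\<^sup>2" and 1: "p 1 = 1 - p 0 - c / (1 - b)"
    by (simp_all add: algebra_simps)
  show c: "c = p 0 * (1 - b)\<^sup>2"
    using assms(5) 0 by simp
  then have "c / (1 - b) = p 0 * (1 - b)"
    using assms(5) by (simp add: power2_eq_square)
  with 1 show p1: "p 1 = 1 - p 0 * (2 - b)"
    by (simp add: algebra_simps)
  show "gf p s = s + p 0 * (1 - s)\<^sup>2 / (1 - b * s)" if "\<bar>b * s\<bar> < 1" for s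
  proof -
    have "gf p s = p 0 + p 1 * s + c * s\<^sup>2 / (1 - b * s)"
      using geometric_tail_sums[OF assms(3) that] by (simp add: gf_def sums_iff)
    also have "\<dots> = s + p 0 * (1 - s)\<^sup>2 / (1 - b * s)"
      unfolding c p1 using that by (simp add: field_simps power2_eq_square)
    finally show ?thesis .
  qed
  have s2: "summable (diffs (diffs p))"
    by (rule summable_if_summable_diffs[OF _ s3])
      (use assms(1) in \<open>auto simp: diffs_def offspring_law_def\<close>)
  \<comment> \<open>The coefficients u k = (k + 1) * (k + 2) * c * b^k of f'' satisfy u (k + 1) - b
    * u k = 2 * c * (k + 2) * b^(k + 1).\<close>
  have "(\<lambda>k. 2 * c * (of_nat (Suc k) * b ^ k)) sums (2 * c * (1 / (1 - b)\<^sup>2))"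
    by (intro sums_mult geometric_deriv_sums) (use assms in auto)
  from sums_of_geometric_recurrence[OF s2 this, of b]
  have u: "diffs (diffs p) sums (2 * c * (1 / (1 - b)\<^sup>2) / (1 - b))"
    using assms(3)[of 0] assms(5) by (simp add: diffs_def assms(3) algebra_simps)
  then show "m2 p = p 0 / (1 - b)"
    using assms(5) by (simp add: m2_def gf_def sums_iff c divide_simps)
  \<comment> \<open>Likewise the coefficients of f''' are driven by 3 * b times those of
    f''.\<close>
  from sums_of_geometric_recurrence[OF s3 sums_mult[OF u, of "3 * b"], of b]
  have "diffs (diffs (diffs p)) sums (3 * b * (2 * c * (1 / (1 - b)\<^sup>2) / (1 - b)) / (1 - b))"
    using assms(3)[of 0] assms(5) by (simp add: diffs_def assms(3) algebra_simps)
  then show "m3 p = p 0 * b / (1 - b)\<^sup>2"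
    using assms(5) by (simp add: m3_def gf_def sums_iff c power2_eq_square)
qed

text \<open>Here f3, f4, f5 form a geometric progression with ratio b / (1 - b), hence f4^2 = f3 *
  f5.\<close>

lemma psi_crit_zero_if_mlf:
  assumes p: "offspring_law p" "critical p" and "modified_linear_fractional p" and x: "0 \<le> x" "x < 1"
  shows "psi_crit p x = 0"
proof -
  obtain c b where cb: "\<And>k. p (Suc (Suc k)) = c * b ^ k" "0 < c" "0 \<le> b" "b < 1"
    using mlf_coeffsE[OF assms(3)] by metis
  note f = critical_mlf_coeffs[OF p cb(1,3,4)]
  have bx: "b * x < 1"
    using cb(3,4) x mult_left_le_one_le[of x b] by auto
  have p0: "p 0 > 0" using f(1) cb(2,4) by (simp add: zero_less_mult_iff)
  define P where "P = p 0"
  have f3: "f3 p x = P / (1 - b * x)"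
    using f(5)[of x] bx cb(3) x by (simp add: f3_def P_def)
  have f4: "f4 p x = P * b / ((1 - b) * (1 - b * x))"
    using bx cb(4) x by (simp add: f4_def f3 f(3) P_def[symmetric] divide_simps) (simp add: algebra_simps)
  have f5: "f5 p x = P * b\<^sup>2 / ((1 - b)\<^sup>2 * (1 - b * x))"
    using bx cb(4) x by (simp add: f5_def f4 f(4) P_def[symmetric] divide_simps) (simp add: algebra_simps power2_eq_square)
  have "(f4 p x)\<^sup>2 / f3 p x = f5 p x"
    unfolding f3 f4 f5 using bx cb(4) p0 by (simp add: P_def[symmetric] power2_eq_square divide_simps)
  moreover have "psi_crit p x = ((f4 p x)\<^sup>2 / f3 p x - f5 p x) / (m2 p)\<^sup>2"
    by (simp add: psi_crit_def diff_divide_distrib mult.commute)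
  ultimately show ?thesis by simp
qed

section \<open>Tail generating functions\<close>

text \<open>Tonelli for a nonnegative array, with convergence assumed for the columns only; that of
  the rows comes out of the proof.\<close>

lemma nonneg_double_sums:
  fixes f :: "nat \<Rightarrow> nat \<Rightarrow> real"
  assumes nn: "\<And>k i. 0 \<le> f k i" and col: "\<And>i. (\<lambda>k. f k i) sums g i" and g: "summable g"
  shows "(\<lambda>k. \<Sum>i. f k i) sums (\<Sum>i. g i)"
proof -
  have hs: "((\<lambda>k. f k i) has_sum g i) UNIV" for i
    by (rule sums_nonneg_imp_has_sum[OF col nn])
  have gn: "g i \<ge> 0" for i using hs[of i] nn by (rule has_sum_nonneg)
  have G: "(g has_sum (\<Sum>i. g i)) UNIV"
    by (rule sums_nonneg_imp_has_sum[OF summable_sums[OF g] gn])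
  have "((\<lambda>(i, k). f k i) has_sum (\<Sum>i. g i)) (UNIV \<times> UNIV)"
  proof (rule has_sum_SigmaI[where g = g])
    show "(\<lambda>(i, k). f k i) summable_on UNIV \<times> UNIV"
      by (rule summable_on_SigmaI[where g = g]) (use hs G nn in \<open>auto simp: summable_on_def\<close>)
  qed (use hs G in auto)
  then have H: "((\<lambda>(k, i). f k i) has_sum (\<Sum>i. g i)) (UNIV \<times> UNIV)"
    by (subst has_sum_swap) (simp add: case_prod_unfold)
  have row: "(f k has_sum (\<Sum>i. f k i)) UNIV" for k
  proof -
    have "(\<lambda>(k, i). f k i) summable_on UNIV \<times> UNIV" using H by (auto simp: summable_on_def)
    from summable_on_SigmaD1[OF this, of k]
    have s: "f k summable_on UNIV" by (simp add: nn)
    show ?thesis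
      by (rule sums_nonneg_imp_has_sum[OF summable_sums[OF summable_on_imp_summable[OF s]] nn])
  qed
  show ?thesis
    by (rule has_sum_imp_sums, rule has_sum_SigmaD[OF H]) (use row in auto)
qed

text \<open>The coefficients in x of the second-order tail function v^(2)(a, x), that is, of the
  divided difference (v(a) - v(x)) / (a - x).\<close>

definition tail_coeff :: "real \<Rightarrow> (nat \<Rightarrow> real) \<Rightarrow> nat \<Rightarrow> real" where
  "tail_coeff a v k = (\<Sum>i. v (Suc (k + i)) * a ^ i)"

lemma summable_tail_coeff_terms:
  fixes v :: "nat \<Rightarrow> real"
  assumes "summable (\<lambda>k. v k * a ^ k)"
  shows "summable (\<lambda>i. v (Suc (k + i)) * a ^ i)"
proof (cases "a = 0")
  case False
  have "summable (\<lambda>i. v (i + Suc k) * a ^ (i + Suc k))"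
    using assms by (rule summable_ignore_initial_segment)
  then have "summable (\<lambda>i. inverse (a ^ Suc k) * (v (i + Suc k) * a ^ (i + Suc k)))"
    by (rule summable_mult)
  then show ?thesis using False by (simp add: power_add field_simps)
next
  case True
  show ?thesis by (rule summable_finite[of "{0}"]) (auto simp: True)
qed

context
  fixes v :: "nat \<Rightarrow> real" and a :: real
  assumes v_nonneg: "\<And>k. 0 \<le> v k" and a_nonneg: "0 \<le> a" and v_summable: "summable (\<lambda>k. v k * a ^ k)"
begin

lemma tail_coeff_nonneg: "0 \<le> tail_coeff a v k"
  unfolding tail_coeff_def
  by (rule suminf_nonneg[OF summable_tail_coeff_terms[OF v_summable]]) (simp add: v_nonneg a_nonneg)

lemma tail_coeff_rec: "tail_coeff a v k = v (Suc k) + a * tail_coeff a v (Suc k)"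
proof -
  have "tail_coeff a v k = v (Suc k) + (\<Sum>i. v (Suc (k + Suc i)) * a ^ Suc i)"
    unfolding tail_coeff_def
    using suminf_split_head[OF summable_tail_coeff_terms[OF v_summable, of k]] by simp
  also have "(\<Sum>i. v (Suc (k + Suc i)) * a ^ Suc i) = (\<Sum>i. a * (v (Suc (Suc k + i)) * a ^ i))"
    by (simp add: mult_ac)
  also have "\<dots> = a * tail_coeff a v (Suc k)"
    unfolding tail_coeff_def by (rule suminf_mult[OF summable_tail_coeff_terms[OF v_summable]])
  finally show ?thesis .
qed

lemma gf_eq_head_tail: "gf v a = v 0 + a * tail_coeff a v 0"
proof -
  have "gf v a = v 0 + (\<Sum>i. v (Suc i) * a ^ Suc i)"
    unfolding gf_def using suminf_split_head[OF v_summable] by simp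
  also have "(\<Sum>i. v (Suc i) * a ^ Suc i) = (\<Sum>i. a * (v (Suc (0 + i)) * a ^ i))"
    by (simp add: mult_ac)
  also have "\<dots> = a * tail_coeff a v 0"
    unfolding tail_coeff_def by (rule suminf_mult[OF summable_tail_coeff_terms[OF v_summable]])
  finally show ?thesis .
qed

text \<open>The recursion \<open>tail_coeff_rec\<close>, multiplied by x^(k + 1) and summed. At x =
  a both sides vanish, so the diagonal value has to be found separately.\<close>

lemma gf_tail_coeff:
  assumes "summable (\<lambda>k. v k * x ^ k)" "summable (\<lambda>k. tail_coeff a v k * x ^ k)"
  shows "(a - x) * gf (tail_coeff a v) x = gf v a - gf v x"
proof -
  let ?S = "tail_coeff a v"
  have S: "(\<lambda>k. ?S k * x ^ k) sums gf ?S x" and V: "(\<lambda>k. v k * x ^ k) sums gf v x"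
    using assms by (simp_all add: gf_def summable_sums)
  have "(\<lambda>k. v (Suc k) * x ^ Suc k) sums (gf v x - v 0)"
    using V by (subst sums_Suc_iff) simp
  moreover have "(\<lambda>k. x * (?S k * x ^ k)) sums (x * gf ?S x)"
    by (rule sums_mult[OF S])
  ultimately have "(\<lambda>k. x * (?S k * x ^ k) - v (Suc k) * x ^ Suc k) sums (x * gf ?S x - (gf v x - v 0))"
    by (intro sums_diff)
  moreover have "x * (?S k * x ^ k) - v (Suc k) * x ^ Suc k = a * (?S (Suc k) * x ^ Suc k)" for k
    by (subst tail_coeff_rec[of k]) (simp add: algebra_simps)
  ultimately have "(\<lambda>k. a * (?S (Suc k) * x ^ Suc k)) sums (x * gf ?S x - (gf v x - v 0))"
    by (simp only:)
  moreover have "(\<lambda>k. ?S (Suc k) * x ^ Suc k) sums (gf ?S x - ?S 0)"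
    using S by (subst sums_Suc_iff) simp
  then have "(\<lambda>k. a * (?S (Suc k) * x ^ Suc k)) sums (a * (gf ?S x - ?S 0))"
    by (rule sums_mult)
  ultimately have "x * gf ?S x - (gf v x - v 0) = a * (gf ?S x - ?S 0)"
    by (rule sums_unique2)
  then show ?thesis unfolding gf_eq_head_tail by (simp add: algebra_simps)
qed

text \<open>The term v (i + 1) * a^i arises from each of the i + 1 ways to split i into two indices,
  which is the factor introduced by differentiation.\<close>

lemma gf_tail_coeff_diag_sums:
  assumes "summable (\<lambda>k. diffs v k * a ^ k)"
  shows "(\<lambda>k. tail_coeff a v k * a ^ k) sums gf (diffs v) a"
proof -
  define f where "f k i = (if k \<le> i then v (Suc i) * a ^ i else 0)" for k i
  have "(\<lambda>k. \<Sum>i. f k i) sums (\<Sum>i. diffs v i * a ^ i)"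
  proof (rule nonneg_double_sums[OF _ _ assms])
    fix i
    have "(\<lambda>k. f k i) sums (\<Sum>k\<in>{..i}. f k i)"
      by (rule sums_finite) (auto simp: f_def)
    then show "(\<lambda>k. f k i) sums (diffs v i * a ^ i)"
      by (simp add: f_def diffs_def mult.assoc)
  qed (simp add: f_def v_nonneg a_nonneg)
  moreover have "(\<Sum>i. f k i) = tail_coeff a v k * a ^ k" for k
  proof -
    have "(\<lambda>i. v (Suc (k + i)) * a ^ i * a ^ k) sums (tail_coeff a v k * a ^ k)"
      unfolding tail_coeff_def
      by (intro sums_mult2 summable_sums summable_tail_coeff_terms[OF v_summable])
    then have "(\<lambda>i. f k (i + k)) sums (tail_coeff a v k * a ^ k)"
      by (simp add: f_def power_add mult_ac add_ac)
    then have "f k sums (tail_coeff a v k * a ^ k)"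
      by (subst (asm) sums_iff_shift) (simp add: f_def)
    then show ?thesis by (simp add: sums_iff)
  qed
  ultimately show ?thesis by (simp add: gf_def)
qed

lemma tail_coeff_power_le: "a > 0 \<Longrightarrow> tail_coeff a v k * a ^ k \<le> gf v a / a"
proof -
  assume a: "a > 0"
  have "tail_coeff a v k * a ^ Suc k \<le> gf v a - sum (\<lambda>i. v i * a ^ i) {..<Suc k}"
  proof -
    have "(\<lambda>i. v (Suc (k + i)) * a ^ i * a ^ Suc k) sums (tail_coeff a v k * a ^ Suc k)"
      unfolding tail_coeff_def
      by (intro sums_mult2 summable_sums summable_tail_coeff_terms[OF v_summable])
    then have "(\<lambda>i. v (i + Suc k) * a ^ (i + Suc k)) sums (tail_coeff a v k * a ^ Suc k)"
      by (simp add: power_add mult_ac add_ac)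
    moreover have "(\<lambda>i. v i * a ^ i) sums gf v a"
      using v_summable by (simp add: gf_def summable_sums)
    then have "(\<lambda>i. v (i + Suc k) * a ^ (i + Suc k)) sums (gf v a - sum (\<lambda>i. v i * a ^ i) {..<Suc k})"
      by (subst sums_iff_shift) simp
    ultimately show ?thesis using sums_unique2 by fastforce
  qed
  also have "\<dots> \<le> gf v a"
    using sum_nonneg[of "{..<Suc k}" "\<lambda>i. v i * a ^ i"] v_nonneg a_nonneg by simp
  finally show ?thesis using a by (simp add: field_simps)
qed

text \<open>By \<open>tail_coeff_power_le\<close> the series is dominated by a geometric one with
  ratio x / a.\<close>

lemma summable_tail_coeff_below:
  assumes "0 \<le> x" "x < a"
  shows "summable (\<lambda>k. tail_coeff a v k * x ^ k)"
proof (rule summable_comparison_test')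
  show "summable (\<lambda>k. gf v a / a * (x / a) ^ k)"
    using assms by (intro summable_mult summable_geometric) auto
  fix k :: nat
  have "tail_coeff a v k * x ^ k = tail_coeff a v k * a ^ k * (x / a) ^ k"
    using assms by (simp add: power_divide)
  also have "\<dots> \<le> gf v a / a * (x / a) ^ k"
    by (rule mult_right_mono[OF tail_coeff_power_le]) (use assms in auto)
  finally show "norm (tail_coeff a v k * x ^ k) \<le> gf v a / a * (x / a) ^ k"
    using tail_coeff_nonneg assms by (simp add: abs_mult)
qed

end

text \<open>Geometric domination fails for x > a. Interchanging the summations exchanges the roles
  of the two points and reduces the claim to the case below.\<close>

lemma summable_tail_coeff_above:
  fixes v :: "nat \<Rightarrow> real"
  assumes v: "\<And>k. 0 \<le> v k" and a: "0 \<le> a" and x: "a < x" and sm: "summable (\<lambda>k. v k * x ^ k)"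
  shows "summable (\<lambda>k. tail_coeff a v k * x ^ k)"
proof -
  have x0: "x > 0" using a x by simp
  define f where "f k i = v (Suc (k + i)) * a ^ i * x ^ k" for k i
  define g where "g i = tail_coeff x v i * a ^ i" for i
  have "(\<lambda>k. \<Sum>i. f k i) sums (\<Sum>i. g i)"
  proof (rule nonneg_double_sums)
    show "summable g"
      unfolding g_def using v x0 sm a x by (intro summable_tail_coeff_below) auto
    show "(\<lambda>k. f k i) sums g i" for i
    proof -
      have "(\<lambda>k. v (Suc (i + k)) * x ^ k * a ^ i) sums (tail_coeff x v i * a ^ i)"
        unfolding tail_coeff_def by (intro sums_mult2 summable_sums summable_tail_coeff_terms sm)
      then show ?thesis by (simp add: f_def g_def mult_ac add_ac)
    qed
  qed (use v a x0 in \<open>auto simp: f_def\<close>)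
  moreover have "(\<Sum>i. f k i) = tail_coeff a v k * x ^ k" for k
  proof -
    have "summable (\<lambda>k. v k * a ^ k)"
      by (rule powser_inside[OF sm]) (use a x in auto)
    from summable_tail_coeff_terms[OF this, of k] show ?thesis
      unfolding f_def tail_coeff_def by (rule suminf_mult2[symmetric])
  qed
  ultimately show ?thesis by (simp add: sums_iff)
qed

text \<open>The resolvent identity for the operators \<^term>\<open>tail_coeff a\<close>.\<close>

lemma tail_coeff_commute:
  fixes v :: "nat \<Rightarrow> real"
  assumes v: "\<And>k. 0 \<le> v k" and ab: "0 \<le> b" "b < a" and sm: "summable (\<lambda>k. v k * a ^ k)"
  shows "(a - b) * tail_coeff a (tail_coeff b v) k = tail_coeff a v k - tail_coeff b v k"
proof -
  \<comment> \<open>After this shift \<open>tail_coeff c v k\<close> is \<open>gf w c\<close>, so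
    the claim becomes the divided-difference identity for w.\<close>
  define w where "w i = v (Suc (k + i))" for i
  have w: "\<And>i. 0 \<le> w i" and sa: "summable (\<lambda>i. w i * a ^ i)"
    using v summable_tail_coeff_terms[OF sm] by (simp_all add: w_def)
  have sb: "summable (\<lambda>i. w i * b ^ i)"
    by (rule powser_inside[OF sa]) (use ab in auto)
  have "tail_coeff b w i = tail_coeff b v (Suc (k + i))" for i
    by (simp add: tail_coeff_def w_def add_ac)
  then have "gf (tail_coeff b w) a = tail_coeff a (tail_coeff b v) k"
    by (simp add: gf_def tail_coeff_def[of a])
  moreover have "gf w c = tail_coeff c v k" for c
    by (simp add: gf_def w_def tail_coeff_def)
  moreover have "(b - a) * gf (tail_coeff b w) a = gf w b - gf w a"
    by (rule gf_tail_coeff[OF w ab(1) sb sa summable_tail_coeff_above[OF w ab sa]])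
  ultimately show ?thesis by (simp add: algebra_simps)
qed

text \<open>The operator preserves a geometric tail and its ratio, and it absorbs one exceptional
  initial coefficient. A modified linear-fractional law has two of these, so two applications make
  its coefficients purely geometric.\<close>

lemma geometric_tail_coeff:
  fixes v :: "nat \<Rightarrow> real"
  assumes v: "\<And>k. v (Suc k) = d * b ^ k" and "\<bar>b * a\<bar> < 1"
  shows "tail_coeff a v k = d / (1 - b * a) * b ^ k"
proof -
  have "(\<lambda>i. d * b ^ k * (b * a) ^ i) sums (d * b ^ k * (1 / (1 - b * a)))"
    by (intro sums_mult geometric_sums) (use assms in auto)
  moreover have "d * b ^ k * (b * a) ^ i = v (Suc (k + i)) * a ^ i" for i
    unfolding v by (simp add: power_add power_mult_distrib)
  ultimately show ?thesis by (simp add: tail_coeff_def sums_iff)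
qed

lemma geometric_gf:
  fixes v :: "nat \<Rightarrow> real"
  assumes v: "\<And>k. v k = d * b ^ k" and "\<bar>b * a\<bar> < 1"
  shows "gf v a = d / (1 - b * a)"
proof -
  have "(\<lambda>i. d * (b * a) ^ i) sums (d * (1 / (1 - b * a)))"
    by (intro sums_mult geometric_sums) (use assms in auto)
  then show ?thesis by (simp add: gf_def v power_mult_distrib sums_iff mult_ac)
qed

text \<open>An \<open>infsum\<close> defaults to 0 without summability. Carrying the convergence
  along lets the value be built up one point at a time.\<close>

definition tail_sum :: "(nat \<Rightarrow> real) \<Rightarrow> real list \<Rightarrow> real \<Rightarrow> bool" where
  "tail_sum v ss T \<longleftrightarrow> ((\<lambda>is. v (sum_list is + length ss - 1) * (\<Prod>j<length ss. (ss ! j) ^ (is ! j)))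
     has_sum T) {is :: nat list. length is = length ss}"

lemma tail_gf_eq: "tail_sum v ss T \<Longrightarrow> tail_gf v ss = T"
  unfolding tail_sum_def tail_gf_def by (rule infsumI)

lemma tail_sum_single:
  assumes "\<And>k. 0 \<le> v k" "0 \<le> x" "summable (\<lambda>k. v k * x ^ k)"
  shows "tail_sum v [x] (gf v x)"
proof -
  have "((\<lambda>k. v k * x ^ k) has_sum gf v x) UNIV"
    unfolding gf_def by (rule sums_nonneg_imp_has_sum) (use assms in auto)
  moreover have "bij_betw (\<lambda>k. [k]) UNIV {is :: nat list. length is = 1}"
    by (rule bij_betwI[of _ _ _ hd]) (auto simp: length_Suc_conv)
  ultimately show ?thesis
    unfolding tail_sum_def by (subst has_sum_reindex_bij_betw[symmetric, where g = "\<lambda>k. [k]" and A = UNIV]) auto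
qed

text \<open>Summing over the index of the first point first replaces v by
  \<open>tail_coeff a v\<close> and lowers the order by one.\<close>

lemma tail_sum_Cons:
  assumes v: "\<And>k. 0 \<le> v k" and a: "0 \<le> a" and sm: "summable (\<lambda>k. v k * a ^ k)"
    and ss: "ss \<noteq> []" "\<forall>s\<in>set ss. 0 \<le> s" and T: "tail_sum (tail_coeff a v) ss T"
  shows "tail_sum v (a # ss) T"
proof -
  define P where "P is = (\<Prod>j<length ss. (ss ! j) ^ (is ! j))" for "is" :: "nat list"
  define B where "B = {is :: nat list. length is = length ss}"
  have P: "P is \<ge> 0" for "is" unfolding P_def using ss by (intro prod_nonneg) auto
  have T': "((\<lambda>is. tail_coeff a v (sum_list is + length ss - 1) * P is) has_sum T) B"
    using T by (simp add: tail_sum_def P_def B_def)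
  have row: "((\<lambda>i. v (sum_list is + length ss + i) * (a ^ i * P is)) has_sum
      tail_coeff a v (sum_list is + length ss - 1) * P is) UNIV" for "is"
  proof (rule sums_nonneg_imp_has_sum)
    have "(\<lambda>i. v (Suc ((sum_list is + length ss - 1) + i)) * a ^ i * P is) sums
        (tail_coeff a v (sum_list is + length ss - 1) * P is)"
      unfolding tail_coeff_def by (intro sums_mult2 summable_sums summable_tail_coeff_terms[OF sm])
    \<comment> \<open>The truncated subtraction is genuine because \<open>ss\<close> is not
      empty.\<close>
    moreover have "Suc ((sum_list is + length ss - 1) + i) = sum_list is + length ss + i" for i
      using ss(1) by (cases ss) auto
    ultimately show "(\<lambda>i. v (sum_list is + length ss + i) * (a ^ i * P is)) sums
        (tail_coeff a v (sum_list is + length ss - 1) * P is)"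
      by (simp only: mult.assoc)
  qed (simp add: v a P)
  have "((\<lambda>(is, i). v (sum_list is + length ss + i) * (a ^ i * P is)) has_sum T) (B \<times> UNIV)"
  proof (rule has_sum_SigmaI)
    show "(\<lambda>(is, i). v (sum_list is + length ss + i) * (a ^ i * P is)) summable_on B \<times> UNIV"
      by (rule summable_on_SigmaI) (use row T' in \<open>auto simp: summable_on_def v a P\<close>)
  qed (use row T' in auto)
  moreover have "bij_betw (\<lambda>(is, i). i # is) (B \<times> UNIV) {is :: nat list. length is = length (a # ss)}"
    by (rule bij_betwI[of _ _ _ "\<lambda>is. (tl is, hd is)"]) (auto simp: B_def length_Suc_conv)
  ultimately show ?thesis
    unfolding tail_sum_def
    by (subst has_sum_reindex_bij_betw[symmetric, where g = "\<lambda>(is, i). i # is" and A = "B \<times> UNIV"])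
      (auto simp: case_prod_unfold P_def prod.lessThan_Suc_shift add_ac mult_ac simp del: prod.lessThan_Suc)
qed

section \<open>The non-critical case\<close>

locale noncritical_law =
  fixes p :: "nat \<Rightarrow> real" and q r :: real
  assumes law: "offspring_law p" and noncrit: "noncritical p q r"
begin

lemma bounds: "0 \<le> q" "q \<le> 1" "1 \<le> r" "q < r"
  using noncrit by (auto simp: noncritical_def extendable_def)

lemma p_nonneg: "0 \<le> p k"
  using law by (simp add: offspring_law_def)

lemma sums_q: "(\<lambda>k. p k * q ^ k) sums q" and sums_r: "(\<lambda>k. p k * r ^ k) sums r"
  using noncrit by (auto simp: noncritical_def extendable_def)

lemma gf_q: "gf p q = q" and gf_r: "gf p r = r"
  using sums_q sums_r by (simp_all add: gf_def sums_iff)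

lemma summable_p: "0 \<le> x \<Longrightarrow> x \<le> r \<Longrightarrow> summable (\<lambda>k. p k * x ^ k)"
  using sums_r bounds by (cases "x = r") (auto simp: sums_iff intro: powser_inside[of p r x])

text \<open>The coefficients in x of f^(2)(q, x) and, with \<open>v2\<close>, of f^(3)(q, r, x), the
  function g.\<close>

abbreviation "v1 \<equiv> tail_coeff q p"
abbreviation "v2 \<equiv> tail_coeff r v1"

lemma v1_nonneg: "0 \<le> v1 k"
  using tail_coeff_nonneg[where v = "p", OF p_nonneg bounds(1) summable_p] bounds by simp

lemma summable_v1: "0 \<le> x \<Longrightarrow> x \<le> r \<Longrightarrow> summable (\<lambda>k. v1 k * x ^ k)"
proof -
  assume x: "0 \<le> x" "x \<le> r"
  have "summable (\<lambda>k. v1 k * r ^ k)"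
    by (rule summable_tail_coeff_above[where v = "p", OF p_nonneg]) (use bounds summable_p in auto)
  then show ?thesis using x bounds by (cases "x = r") (auto intro: powser_inside[of v1 r x])
qed

lemma v2_nonneg: "0 \<le> v2 k"
  using tail_coeff_nonneg[where v = "v1", OF v1_nonneg, where a = r] summable_v1[of r] bounds by simp

lemma v2_eq: "v2 k = (tail_coeff r p k - v1 k) / (r - q)"
  using tail_coeff_commute[where v = "p", OF p_nonneg bounds(1,4) summable_p, where k = k] bounds by (simp add: field_simps)

text \<open>The chord of f between its two fixed points has slope 1.\<close>

lemma gf_v1_r: "gf v1 r = 1"
proof -
  have "(q - r) * gf v1 r = gf p q - gf p r"
    by (rule gf_tail_coeff[where v = "p", OF p_nonneg]) (use bounds summable_p summable_v1 in auto)
  then have "(r - q) * gf v1 r = (r - q) * 1" unfolding gf_q gf_r by (simp add: algebra_simps)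
  then show "gf v1 r = 1" using bounds by simp
qed

text \<open>Convergence of g at r itself is a diagonal case, and rests on finiteness of f'(r):
  \<open>v2_eq\<close> reduces it to the diagonal series at r minus a convergent one.\<close>

lemma v2_sums_r: "(\<lambda>k. v2 k * r ^ k) sums ((gf (diffs p) r - 1) / (r - q))"
proof -
  have "(\<lambda>k. v1 k * r ^ k) sums gf v1 r"
    using summable_v1[of r] bounds by (simp add: gf_def summable_sums)
  moreover have "(\<lambda>k. tail_coeff r p k * r ^ k) sums gf (diffs p) r"
    by (rule gf_tail_coeff_diag_sums[where v = "p", OF p_nonneg])
      (use bounds summable_p noncrit in \<open>auto simp: noncritical_def\<close>)
  ultimately have "(\<lambda>k. (tail_coeff r p k * r ^ k - v1 k * r ^ k) / (r - q)) sums ((gf (diffs p) r - 1) / (r - q))"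
    using gf_v1_r by (intro sums_divide sums_diff) auto
  then show ?thesis by (simp add: v2_eq left_diff_distrib)
qed

lemma summable_v2: "0 \<le> x \<Longrightarrow> x \<le> r \<Longrightarrow> summable (\<lambda>k. v2 k * x ^ k)"
  using v2_sums_r bounds by (cases "x = r") (auto simp: sums_iff intro: powser_inside[of v2 r x])

lemma summable_v1q: "0 \<le> x \<Longrightarrow> x \<le> r \<Longrightarrow> summable (\<lambda>k. tail_coeff q v1 k * x ^ k)"
proof -
  assume x: "0 \<le> x" "x \<le> r"
  have "summable (\<lambda>k. tail_coeff q v1 k * r ^ k)"
    by (rule summable_tail_coeff_above[where v = "v1", OF v1_nonneg]) (use bounds summable_v1 in auto)
  then show ?thesis
    using x bounds by (cases "x = r") (auto intro: powser_inside[of "tail_coeff q v1" r x])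
qed

lemma v1q_nonneg: "0 \<le> tail_coeff q v1 k"
  using tail_coeff_nonneg[where v = "v1", OF v1_nonneg bounds(1) summable_v1] bounds by simp

lemma tail_gf_values:
  assumes x: "0 \<le> x" "x < r"
  shows "tail_gf p [q, r, x] = gf v2 x"
    and "tail_gf p [q, q, r, x] = gf (tail_coeff r (tail_coeff q v1)) x"
    and "tail_gf p [q, r, r, x] = gf (tail_coeff r v2) x"
proof -
  note nn = tail_coeff_nonneg p_nonneg v1_nonneg v2_nonneg v1q_nonneg
  note sm = summable_p summable_v1 summable_v2 summable_v1q
  show "tail_gf p [q, r, x] = gf v2 x"
    by (rule tail_gf_eq, intro tail_sum_Cons tail_sum_single)
      (use x bounds in \<open>auto intro!: nn sm\<close>)
  show "tail_gf p [q, q, r, x] = gf (tail_coeff r (tail_coeff q v1)) x"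
    by (rule tail_gf_eq, intro tail_sum_Cons tail_sum_single)
      (use x bounds in \<open>auto intro!: nn sm summable_tail_coeff_below\<close>)
  show "tail_gf p [q, r, r, x] = gf (tail_coeff r v2) x"
    by (rule tail_gf_eq, intro tail_sum_Cons tail_sum_single)
      (use x bounds in \<open>auto intro!: nn sm summable_tail_coeff_below\<close>)
qed

text \<open>Otherwise f would be affine with two distinct fixed points, forcing p 1 = 1.\<close>

lemma ex_offspring_ge_2: "\<exists>k\<ge>2. p k \<noteq> 0"
proof (rule ccontr)
  assume none: "\<not> ?thesis"
  have "x = p 0 + p 1 * x" if "(\<lambda>k. p k * x ^ k) sums x" for x
  proof -
    have "(\<lambda>k. p k * x ^ k) sums (\<Sum>k\<in>{0, 1}. p k * x ^ k)"
      by (rule sums_finite) (use none in \<open>auto simp: numeral_2_eq_2 Suc_le_eq not_less_eq_eq\<close>)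
    with that sums_unique2 show ?thesis by fastforce
  qed
  from this[OF sums_q] this[OF sums_r] have "p 1 * (r - q) = 1 * (r - q)" by (simp add: algebra_simps)
  then show False using bounds law by (simp add: offspring_law_def)
qed

lemma gf_v2_pos: "0 \<le> x \<Longrightarrow> x \<le> r \<Longrightarrow> 0 < gf v2 x"
proof -
  assume x: "0 \<le> x" "x \<le> r"
  obtain i where i: "p (Suc (Suc i)) \<noteq> 0"
    using ex_offspring_ge_2 by (metis Suc_le_D numeral_2_eq_2 Suc_le_mono)
  have "p (Suc (Suc i)) \<le> v1 (Suc i)"
    using tail_coeff_rec[where v = "p", OF p_nonneg bounds(1), where k = "Suc i"] sums_q v1_nonneg bounds(1) by (simp add: sums_iff)
  then have pos: "0 < v1 (Suc i)" using i p_nonneg[of "Suc (Suc i)"] by linarith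
  have "0 < v2 0"
    unfolding tail_coeff_def[of r]
    by (rule suminf_pos2[where i = i])
      (use pos v1_nonneg bounds summable_tail_coeff_terms[OF summable_v1, of r 0] in auto)
  moreover have "v2 0 \<le> gf v2 x"
    using sum_le_suminf[OF summable_v2[OF x], of "{0}"] v2_nonneg x by (simp add: gf_def)
  ultimately show ?thesis by linarith
qed

lemma gf_v2_mono: "gf v2 q \<le> gf v2 r"
  unfolding gf_def
  by (rule suminf_le) (use summable_v2 bounds v2_nonneg in \<open>auto intro!: mult_left_mono power_mono\<close>)

lemma gf_v1: "0 \<le> x \<Longrightarrow> x < r \<Longrightarrow> gf v1 x = 1 - (r - x) * gf v2 x"
  using gf_tail_coeff[where v = "v1", OF v1_nonneg, where a = r and x = x] summable_v1 summable_v2 bounds gf_v1_r by auto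

lemma gf_p: "0 \<le> x \<Longrightarrow> x < r \<Longrightarrow> gf p x = x - (x - q) * (r - x) * gf v2 x"
  using gf_tail_coeff[where v = "p", OF p_nonneg bounds(1), where x = x] summable_p summable_v1 bounds gf_v1[of x] gf_q
  by (auto simp: algebra_simps)

lemma alpha_eq: "alpha p q = (r - q) * gf v2 q"
proof -
  have "summable (\<lambda>k. diffs p k * q ^ k)"
    by (rule powser_inside[of _ r]) (use noncrit bounds in \<open>auto simp: noncritical_def\<close>)
  from gf_tail_coeff_diag_sums[where v = "p", OF p_nonneg bounds(1) _ this]
  have "gf (diffs p) q = gf v1 q" using summable_p bounds by (simp add: gf_def sums_iff)
  then show ?thesis using gf_v1[of q] bounds by (simp add: alpha_def)
qed

lemma diffs_r_eq: "gf (diffs p) r - 1 = (r - q) * gf v2 r"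
  using v2_sums_r bounds by (simp add: gf_def[of v2] sums_iff)

lemma gam_eq: "gam p q r = gf v2 q / gf v2 r"
  unfolding gam_def alpha_eq diffs_r_eq using bounds by simp

lemma psi_zero_imp:
  assumes x: "0 \<le> x" "x < r" "x \<noteq> q" and psi: "psi p q r x = 0"
  shows "gf v2 x * ((r - x) + gam p q r * (x - q)) = (r - q) * gf v2 q"
proof -
  define g where "g = gf v2"
  define w where "w = gf (tail_coeff q v1)"
  define Ta where "Ta = gf (tail_coeff r (tail_coeff q v1)) x"
  define Tb where "Tb = gf (tail_coeff r v2) x"
  have "g x > 0" using gf_v2_pos x by (simp add: g_def)
  then have T: "Ta = gam p q r * Tb"
    using psi unfolding psi_def tail_gf_values[OF x(1,2)] by (simp add: Ta_def Tb_def g_def)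
  have Tb: "(r - x) * Tb = g r - g x"
    unfolding Tb_def g_def
    by (rule gf_tail_coeff[where v = "v2", OF v2_nonneg])
      (use bounds x summable_v2 summable_tail_coeff_below[where v = "v2", OF v2_nonneg] in auto)
  have Ta: "(r - x) * Ta = w r - w x"
    unfolding Ta_def w_def
    by (rule gf_tail_coeff[where v = "tail_coeff q v1", OF v1q_nonneg])
      (use bounds x summable_v1q summable_tail_coeff_below[where v = "tail_coeff q v1", OF v1q_nonneg] in auto)
  have w: "(q - y) * w y = gf v1 q - gf v1 y" if "0 \<le> y" "y \<le> r" for y
    unfolding w_def
    by (rule gf_tail_coeff[where v = "v1", OF v1_nonneg])
      (use bounds that summable_v1 summable_v1q in auto)
  \<comment> \<open>Symmetry of the tail functions in their arguments: f^(3)(q, q, r) = f^(3)(q, r,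
    q).\<close>
  have "(r - q) * w r = (r - q) * g q"
    using w[of r] bounds gf_v1[of q] gf_v1_r by (simp add: g_def algebra_simps)
  then have wr: "w r = g q" using bounds by simp
  have wx: "(x - q) * w x = (r - q) * g q - (r - x) * g x"
    using w[of x] x bounds gf_v1[of q] gf_v1[of x] by (simp add: g_def algebra_simps)
  have "(r - x) * ((x - q) * Ta) = (x - q) * ((r - x) * Ta)" by simp
  also have "\<dots> = (x - q) * g q - (x - q) * w x" unfolding Ta wr by (simp add: algebra_simps)
  also have "\<dots> = (r - x) * (g x - g q)" unfolding wx by (simp add: algebra_simps)
  \<comment> \<open>Now \<open>Ta\<close> is the divided difference of g at q and x, as
    \<open>Tb\<close> is the one at r and x. The detour through \<open>w\<close> is needed because
    the operators were applied in the order q, q, r.\<close>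
  finally have "(x - q) * Ta = g x - g q" using x by simp
  then have "(r - x) * (g x - g q) = gam p q r * (x - q) * ((r - x) * Tb)"
    unfolding T by (simp add: mult_ac)
  also have "\<dots> = (x - q) * (gam p q r * g r - gam p q r * g x)"
    unfolding Tb by (simp add: algebra_simps)
  also have "gam p q r * g r = g q"
    using gf_v2_pos[of r] bounds by (simp add: gam_eq g_def)
  finally show ?thesis unfolding g_def[symmetric] by (simp add: algebra_simps)
qed

lemma mlf_if_psi_zero:
  assumes psi: "\<And>x. 0 \<le> x \<Longrightarrow> x < r \<Longrightarrow> psi p q r x = 0"
  shows "modified_linear_fractional p"
proof -
  obtain k where k: "k \<ge> 2" "p k \<noteq> 0" using ex_offspring_ge_2 by blast
  define c where "c = gam p q r"
  define K where "K = (r - q) * gf v2 q"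
  \<comment> \<open>This is g(q) / g(r), and g has nonnegative coefficients.\<close>
  have c: "0 < c" "c \<le> 1"
    using gf_v2_pos[of q] gf_v2_pos[of r] gf_v2_mono bounds by (simp_all add: c_def gam_eq)
  show ?thesis
  \<comment> \<open>The denominator is (r - x) + c * (x - q), sorted by powers of x.\<close>
  proof (rule mlfI_rational[OF law k, of "1 - c" "r - c * q"])
    show "0 \<le> 1 - c" using c by simp
    \<comment> \<open>If r = 1, then q < 1 and the second summand is positive.\<close>
    have "0 < r - 1 + c * (1 - q)"
      using bounds c by (cases "r = 1") (auto intro!: add_pos_nonneg)
    then show "1 - c < r - c * q" by (simp add: algebra_simps)
    fix x :: real assume x: "0 < x" "x < 1"
    then have xr: "0 \<le> x" "x < r" using bounds by auto
    have g: "gf v2 x * (r - c * q - (1 - c) * x) = K"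
    proof (cases "x = q")
      case False
      show ?thesis
        using psi_zero_imp[OF xr False psi[OF xr]] by (simp add: c_def K_def algebra_simps)
    qed (simp add: K_def algebra_simps)
    have "gf p x * (r - c * q - (1 - c) * x) =
        x * (r - c * q - (1 - c) * x) - (x - q) * (r - x) * (gf v2 x * (r - c * q - (1 - c) * x))"
      unfolding gf_p[OF xr] by (simp add: algebra_simps)
    also have "\<dots> = q * r * K + (r - c * q - (q + r) * K) * x + (K - (1 - c)) * x\<^sup>2"
      unfolding g by (simp add: algebra_simps power2_eq_square)
    finally show "gf p x * (r - c * q - (1 - c) * x) =
        q * r * K + (r - c * q - (q + r) * K) * x + (K - (1 - c)) * x\<^sup>2" .
  qed
qed

section \<open>Closed forms for a geometric tail in the non-critical case\<close>

context
  fixes c b :: real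
  assumes coeffs: "\<And>k. p (Suc (Suc k)) = c * b ^ k" and c: "0 < c" and b: "0 \<le> b" "b < 1"
begin

text \<open>The closed form of f is only asserted where b * s < 1. That r lies there follows from
  convergence of f at r, which makes the powers of b * r summable.\<close>

lemma b_r: "b * r < 1"
proof -
  have "summable (\<lambda>k. p (Suc (Suc k)) * r ^ Suc (Suc k))"
    using summable_p[of r] bounds by (simp add: summable_Suc_iff[of "\<lambda>k. p (Suc k) * r ^ Suc k"] summable_Suc_iff[of "\<lambda>k. p k * r ^ k"] del: power_Suc)
  then have "summable (\<lambda>k. 1 / (c * r\<^sup>2) * (p (Suc (Suc k)) * r ^ Suc (Suc k)))"
    by (rule summable_mult)
  moreover have "1 / (c * r\<^sup>2) * (p (Suc (Suc k)) * r ^ Suc (Suc k)) = (b * r) ^ k" for k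
    using c bounds by (simp add: coeffs power_mult_distrib power2_eq_square field_simps)
  ultimately have "summable (\<lambda>k. (b * r) ^ k)" by (simp only:)
  then show ?thesis by (simp add: summable_geometric_iff abs_less_iff)
qed

lemma b_less: "0 \<le> x \<Longrightarrow> x \<le> r \<Longrightarrow> \<bar>b * x\<bar> < 1"
  using b_r b mult_left_mono[of x r b] by auto

lemma gf_v2_mlf: "0 \<le> x \<Longrightarrow> x \<le> r \<Longrightarrow> gf v2 x = c / ((1 - b * q) * (1 - b * r) * (1 - b * x))"
proof -
  assume x: "0 \<le> x" "x \<le> r"
  have "v1 (Suc k) = c / (1 - b * q) * b ^ k" for k
    using geometric_tail_coeff[of "\<lambda>k. p (Suc k)" c b q k, OF coeffs] b_less[of q] bounds
    by (simp add: tail_coeff_def)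
  from geometric_gf[OF geometric_tail_coeff[OF this b_less] b_less[OF x]]
  show ?thesis using bounds by (simp add: field_simps)
qed

lemma gam_mlf: "gam p q r = (1 - b * r) / (1 - b * q)"
proof -
  have "gf v2 q = c / ((1 - b * q) * (1 - b * r) * (1 - b * q))"
    "gf v2 r = c / ((1 - b * q) * (1 - b * r) * (1 - b * r))"
    by (rule gf_v2_mlf; use bounds in simp)+
  moreover have "1 - b * q \<noteq> 0" "1 - b * r \<noteq> 0"
    using b_less[of q] b_less[of r] bounds by auto
  moreover have "c / (X * Y * X) / (c / (X * Y * Y)) = Y / X" if "X \<noteq> 0" "Y \<noteq> 0" for X Y
    using c that by (simp add: divide_simps)
  ultimately show ?thesis by (simp only: gam_eq)
qed

text \<open>The affine factor equals (r - q) * (1 - b * x) / (1 - b * q): gamma is exactly the value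
  for which it cancels the denominator 1 - b * x of g.\<close>

lemma gf_v2_gam_mlf:
  assumes "0 \<le> x" "x \<le> r"
  shows "gf v2 x * ((r - x) + gam p q r * (x - q)) = alpha p q"
proof -
  have nz: "1 - b * q \<noteq> 0" "1 - b * r \<noteq> 0" "1 - b * x \<noteq> 0"
    using b_less[of q] b_less[of r] b_less[of x] bounds assms by auto
  have "(1 - b * q) * ((r - x) + gam p q r * (x - q)) = (r - q) * (1 - b * x)"
    unfolding gam_mlf using nz by (simp add: distrib_left) (simp add: algebra_simps)
  then have "(r - x) + gam p q r * (x - q) = (r - q) * (1 - b * x) / (1 - b * q)"
    using nz by (simp add: nonzero_eq_divide_eq mult.commute)
  moreover have "gf v2 x = c / ((1 - b * q) * (1 - b * r) * (1 - b * x))"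
    "gf v2 q = c / ((1 - b * q) * (1 - b * r) * (1 - b * q))"
    by (rule gf_v2_mlf; use bounds assms in simp)+
  ultimately show ?thesis
    unfolding alpha_eq using nz by simp
qed

lemma continuous_on_gf_mlf: "continuous_on {0..r} (gf p)"
proof -
  have "continuous_on {0..r} (\<lambda>x. p 0 + p 1 * x + c * x\<^sup>2 / (1 - b * x))"
    by (intro continuous_intros) (use b_less in force)
  moreover have "p 0 + p 1 * x + c * x\<^sup>2 / (1 - b * x) = gf p x" if "x \<in> {0..r}" for x
    using geometric_tail_sums[OF coeffs b_less[of x]] that by (simp add: gf_def sums_iff)
  ultimately show ?thesis by (rule continuous_on_eq)
qed

text \<open>Each point a in the list contributes a factor 1 / (1 - b * a). Replacing one q by r
  therefore multiplies the tail function by (1 - b * q) / (1 - b * r), the inverse of gamma.\<close>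

lemma psi_zero_if_mlf:
  assumes x: "0 \<le> x" "x < r"
  shows "psi p q r x = 0"
proof -
  have xr: "0 \<le> x" "x \<le> r" using x by auto
  have q: "\<bar>b * q\<bar> < 1" and r: "\<bar>b * r\<bar> < 1" using b_less[of q] b_less[of r] bounds by auto
  have v1: "v1 (Suc k) = c / (1 - b * q) * b ^ k" for k
    using geometric_tail_coeff[of "\<lambda>k. p (Suc k)" c b q k, OF coeffs q]
    by (simp add: tail_coeff_def)
  have v1q: "tail_coeff q v1 (Suc k) = c / (1 - b * q) / (1 - b * q) * b * b ^ k" for k
    using geometric_tail_coeff[OF v1 q, of "Suc k"] by simp
  have v2: "v2 (Suc k) = c / (1 - b * q) / (1 - b * r) * b * b ^ k" for k
    using geometric_tail_coeff[OF v1 r, of "Suc k"] by simp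
  have "gf (tail_coeff r (tail_coeff q v1)) x = c / (1 - b * q) / (1 - b * q) * b / (1 - b * r) / (1 - b * x)"
    "gf (tail_coeff r v2) x = c / (1 - b * q) / (1 - b * r) * b / (1 - b * r) / (1 - b * x)"
    by (rule geometric_gf[OF geometric_tail_coeff[OF v1q r] b_less[OF xr]])
      (rule geometric_gf[OF geometric_tail_coeff[OF v2 r] b_less[OF xr]])
  moreover have "gam p q r = (1 - b * r) / (1 - b * q)" by (rule gam_mlf)
  ultimately show ?thesis
    unfolding psi_def tail_gf_values[OF x] using q r by (simp add: mult_ac)
qed

end

end

section \<open>First-generation decomposition of the process\<close>

text \<open>Labels carry the latest birth at the head, so the subtree of the i-th child of the
  ancestor consists of the labels w @ [i]. The first-generation decomposition thus takes place at
  the end of the list, opposite to the primitive recursion.\<close>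

lemma realised_append:
  "realised N \<omega> (w @ [i]) \<longleftrightarrow>
     (\<exists>k. N [] \<omega> = Some k \<and> i < k) \<and> realised (\<lambda>u. N (u @ [i])) \<omega> w"
  by (induction w) auto

lemma birth_time_append: "birth_time L \<omega> (w @ [i]) = L [] \<omega> + birth_time (\<lambda>u. L (u @ [i])) \<omega> w"
  by (induction w) auto

lemma death_time_append: "death_time L \<omega> (w @ [i]) = L [] \<omega> + death_time (\<lambda>u. L (u @ [i])) \<omega> w"
  by (simp add: death_time_def birth_time_append)

lemma birth_time_nonneg: "(\<And>u. 0 \<le> L u \<omega>) \<Longrightarrow> 0 \<le> birth_time L \<omega> w"
  by (induction w) auto

lemma ex_label_iff: "(\<exists>u. P u) \<longleftrightarrow> P [] \<or> (\<exists>w i. P (w @ [i]))"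
  by (metis rev_exhaust)

text \<open>Dead particles are included; infinitude of this set is what explosion means.\<close>

definition born :: "(nat list \<Rightarrow> 'a \<Rightarrow> real) \<Rightarrow> (nat list \<Rightarrow> 'a \<Rightarrow> nat option) \<Rightarrow> real \<Rightarrow> 'a \<Rightarrow> nat list set"
  where "born L N t \<omega> = {u. realised N \<omega> u \<and> birth_time L \<omega> u \<le> t}"

lemma born_childless:
  assumes "\<And>u. 0 \<le> L u \<omega>" "0 \<le> t" "t < L [] \<omega> \<or> N [] \<omega> = None"
  shows "born L N t \<omega> = {[]}"
proof -
  have "u = []" if "u \<in> born L N t \<omega>" for u
  proof (cases u rule: rev_cases)
    case (snoc w i)
    have "0 \<le> birth_time (\<lambda>u. L (u @ [i])) \<omega> w" by (rule birth_time_nonneg) (rule assms(1))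
    with that snoc assms(3) show ?thesis
      by (auto simp: born_def realised_append birth_time_append)
  qed
  then show ?thesis using assms(2) by (auto simp: born_def)
qed

context
  fixes L :: "nat list \<Rightarrow> 'a \<Rightarrow> real" and N :: "nat list \<Rightarrow> 'a \<Rightarrow> nat option" and \<omega> k t
  assumes first: "N [] \<omega> = Some k" "L [] \<omega> \<le> t" "0 \<le> t"
begin

abbreviation "sub_L i \<equiv> \<lambda>u. L (u @ [i])"
abbreviation "sub_N i \<equiv> \<lambda>u. N (u @ [i])"

lemma born_decomp:
  "born L N t \<omega> = insert [] (\<Union>i<k. (\<lambda>w. w @ [i]) ` born (sub_L i) (sub_N i) (t - L [] \<omega>) \<omega>)"
proof (rule set_eqI)
  fix u show "u \<in> born L N t \<omega> \<longleftrightarrow>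
      u \<in> insert [] (\<Union>i<k. (\<lambda>w. w @ [i]) ` born (sub_L i) (sub_N i) (t - L [] \<omega>) \<omega>)"
    by (cases u rule: rev_cases)
      (use first in \<open>auto simp: born_def realised_append birth_time_append le_diff_eq add_ac\<close>)
qed

lemma alive_decomp:
  "alive L N t \<omega> = (\<Union>i<k. (\<lambda>w. w @ [i]) ` alive (sub_L i) (sub_N i) (t - L [] \<omega>) \<omega>)"
proof (rule set_eqI)
  fix u show "u \<in> alive L N t \<omega> \<longleftrightarrow>
      u \<in> (\<Union>i<k. (\<lambda>w. w @ [i]) ` alive (sub_L i) (sub_N i) (t - L [] \<omega>) \<omega>)"
    by (cases u rule: rev_cases)
      (use first in \<open>auto simp: alive_def realised_append birth_time_append death_time_append
         le_diff_eq diff_less_eq add_ac\<close>, auto simp: death_time_def)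
qed

lemma killed_decomp:
  "killed L N t \<omega> \<longleftrightarrow> (\<exists>i<k. killed (sub_L i) (sub_N i) (t - L [] \<omega>) \<omega>)"
  unfolding killed_def
  by (subst ex_label_iff)
    (use first in \<open>auto simp: realised_append death_time_append le_diff_eq add_ac\<close>)

end

text \<open>
  The generating function of the population at time \<open>t\<close>, restricted to the event that no particle
  of generation \<open>n\<close> is born by then; the tree is given by the marks (life length, outcome).
\<close>

primrec trunc_gf :: "ennreal \<Rightarrow> nat \<Rightarrow> real \<Rightarrow> (nat list \<Rightarrow> real \<times> nat option) \<Rightarrow> ennreal" where
  "trunc_gf s 0 t x = 0"
| "trunc_gf s (Suc n) t x =
     (if t < fst (x []) then s
      else case snd (x []) of None \<Rightarrow> 0
        | Some k \<Rightarrow> \<Prod>i<k. trunc_gf s n (t - fst (x [])) (\<lambda>w. x (w @ [i])))"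

lemma trunc_gf_mono: "trunc_gf s n t x \<le> trunc_gf s (Suc n) t x"
proof (induction n arbitrary: t x)
  case (Suc n)
  have "(\<Prod>i<k. trunc_gf s n (t - fst (x [])) (\<lambda>w. x (w @ [i]))) \<le>
      (\<Prod>i<k. trunc_gf s (Suc n) (t - fst (x [])) (\<lambda>w. x (w @ [i])))" for k
    by (induction k) (auto intro!: mult_mono Suc simp del: trunc_gf.simps)
  then show ?case
    by (subst (1 2) trunc_gf.simps(2)) (auto split: option.split simp del: trunc_gf.simps)
qed simp

text \<open>Finiteness is proved in the same induction, since cardinalities add up over the subtrees
  only for finite sets. It holds because a tree of bounded height in which every particle has
  finitely many children is finite.\<close>

lemma trunc_gf_pathwise:
  assumes "\<And>u. 0 \<le> L u \<omega>" "0 \<le> t"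
  shows "trunc_gf s n t (\<lambda>u. (L u \<omega>, N u \<omega>)) =
      (if killed L N t \<omega> \<or> (\<exists>u\<in>born L N t \<omega>. n \<le> length u) then 0 else s ^ card (alive L N t \<omega>))
    \<and> ((\<forall>u\<in>born L N t \<omega>. length u < n) \<longrightarrow> finite (born L N t \<omega>))"
  using assms
proof (induction n arbitrary: L N t)
  case 0
  \<comment> \<open>The ancestor has generation 0, so the cut at height 0 discards every
    tree.\<close>
  then have "[] \<in> born L N t \<omega>" by (simp add: born_def)
  then show ?case by auto
next
  case (Suc n)
  show ?case
  proof (cases "t < L [] \<omega> \<or> N [] \<omega> = None")
    case True
    have B: "born L N t \<omega> = {[]}" by (rule born_childless) (use Suc.prems True in auto)
    show ?thesis
    proof (cases "t < L [] \<omega>")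
      case t: True
      have "alive L N t \<omega> = {[]}"
        using B t Suc.prems by (auto simp: alive_def born_def death_time_def)
      moreover have "\<not> killed L N t \<omega>"
      proof
        assume "killed L N t \<omega>"
        then obtain u where u: "realised N \<omega> u" "death_time L \<omega> u \<le> t" by (auto simp: killed_def)
        then have "u \<in> born L N t \<omega>"
          using Suc.prems(1)[of u] by (auto simp: born_def death_time_def)
        then show False using B u t by (simp add: death_time_def)
      qed
      ultimately show ?thesis using t B by simp
    next
      case False
      then have "killed L N t \<omega>"
        using True unfolding killed_def by (intro exI[of _ "[]"]) (auto simp: death_time_def)
      then show ?thesis using True False B by simp
    qed
  next
    case False
    then obtain k where k: "N [] \<omega> = Some k" "L [] \<omega> \<le> t" by auto
    note dec = born_decomp[of N \<omega> k L t, OF k Suc.prems(2)] alive_decomp[of N \<omega> k L t, OF k Suc.prems(2)]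
      killed_decomp[of N \<omega> k L t, OF k Suc.prems(2)]
    define \<tau> where "\<tau> = t - L [] \<omega>"
    define Bi where "Bi i = born (\<lambda>u. L (u @ [i])) (\<lambda>u. N (u @ [i])) \<tau> \<omega>" for i
    define Ai where "Ai i = alive (\<lambda>u. L (u @ [i])) (\<lambda>u. N (u @ [i])) \<tau> \<omega>" for i
    define Ki where "Ki i = killed (\<lambda>u. L (u @ [i])) (\<lambda>u. N (u @ [i])) \<tau> \<omega>" for i
    have B: "born L N t \<omega> = insert [] (\<Union>i<k. (\<lambda>w. w @ [i]) ` Bi i)"
      and A: "alive L N t \<omega> = (\<Union>i<k. (\<lambda>w. w @ [i]) ` Ai i)"
      and K: "killed L N t \<omega> \<longleftrightarrow> (\<exists>i<k. Ki i)"
      using dec by (simp_all add: Bi_def Ai_def Ki_def \<tau>_def)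
    have IH: "trunc_gf s n \<tau> (\<lambda>u. (L (u @ [i]) \<omega>, N (u @ [i]) \<omega>)) =
        (if Ki i \<or> (\<exists>u\<in>Bi i. n \<le> length u) then 0 else s ^ card (Ai i))"
      and fin: "(\<forall>u\<in>Bi i. length u < n) \<Longrightarrow> finite (Bi i)" for i
      using Suc.IH[of "\<lambda>u. L (u @ [i])" \<tau> "\<lambda>u. N (u @ [i])"] Suc.prems k
      by (simp_all add: Bi_def Ai_def Ki_def \<tau>_def)
    have long: "(\<exists>u\<in>born L N t \<omega>. Suc n \<le> length u) \<longleftrightarrow> (\<exists>i<k. \<exists>w\<in>Bi i. n \<le> length w)"
      unfolding B by auto
    have AB: "Ai i \<subseteq> Bi i" for i by (auto simp: Ai_def Bi_def alive_def born_def)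
    have step: "trunc_gf s (Suc n) t (\<lambda>u. (L u \<omega>, N u \<omega>)) =
        (\<Prod>i<k. if Ki i \<or> (\<exists>u\<in>Bi i. n \<le> length u) then 0 else s ^ card (Ai i))"
      using k by (simp add: IH[symmetric] \<tau>_def)
    show ?thesis
    proof (cases "\<exists>i<k. Ki i \<or> (\<exists>w\<in>Bi i. n \<le> length w)")
      case True
      then have "trunc_gf s (Suc n) t (\<lambda>u. (L u \<omega>, N u \<omega>)) = 0"
        unfolding step by (intro prod_zero) auto
      moreover have "killed L N t \<omega> \<or> (\<exists>u\<in>born L N t \<omega>. Suc n \<le> length u)"
        unfolding K long using True by blast
      moreover have "finite (born L N t \<omega>)" if "\<forall>u\<in>born L N t \<omega>. length u < Suc n"
        unfolding B using that long by (auto intro!: fin simp: not_le)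
      ultimately show ?thesis by simp
    next
      case False
      have finB: "finite (Bi i)" if "i < k" for i
        by (rule fin) (use False that in \<open>auto simp: not_le\<close>)
      have "card (alive L N t \<omega>) = (\<Sum>i<k. card ((\<lambda>w. w @ [i]) ` Ai i))"
        unfolding A
        by (rule card_UN_disjoint) (auto intro: finite_subset[OF AB finB])
      also have "\<dots> = (\<Sum>i<k. card (Ai i))"
        by (intro sum.cong card_image) (auto simp: inj_on_def)
      finally have "trunc_gf s (Suc n) t (\<lambda>u. (L u \<omega>, N u \<omega>)) = s ^ card (alive L N t \<omega>)"
        unfolding step using False by (simp add: power_sum)
      moreover have "finite (born L N t \<omega>)"
        unfolding B using finB by auto
      ultimately show ?thesis unfolding K long using False by auto
    qed
  qed
qed

text \<open>Along each path the truncations are eventually constant. If finitely many particles are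
  born, their heights are bounded; if infinitely many are, every truncation is 0, and so is
  \<open>gpow s None\<close>.\<close>

lemma SUP_trunc_gf:
  assumes nn: "\<And>u. 0 \<le> L u \<omega>" and t: "0 \<le> t" and s: "0 \<le> s"
  shows "(SUP n. trunc_gf (ennreal s) n t (\<lambda>u. (L u \<omega>, N u \<omega>))) = ennreal (gpow s (population L N t \<omega>))"
proof -
  define V where "V n = trunc_gf (ennreal s) n t (\<lambda>u. (L u \<omega>, N u \<omega>))" for n
  define v where "v = ennreal (gpow s (population L N t \<omega>))"
  have path: "V n = (if killed L N t \<omega> \<or> (\<exists>u\<in>born L N t \<omega>. n \<le> length u) then 0
        else ennreal s ^ card (alive L N t \<omega>))
      \<and> ((\<forall>u\<in>born L N t \<omega>. length u < n) \<longrightarrow> finite (born L N t \<omega>))" for n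
    unfolding V_def by (rule trunc_gf_pathwise) (use nn t in auto)
  note V = conjunct1[OF path] and fin = conjunct2[OF path, rule_format]
  have ex: "exploded L N t \<omega> \<longleftrightarrow> infinite (born L N t \<omega>)"
    by (simp add: exploded_def born_def)
  have "\<forall>\<^sub>F n in sequentially. V n = v"
  proof (cases "finite (born L N t \<omega>)")
    case True
    then have "finite (length ` born L N t \<omega>)" by simp
    then obtain m where "\<forall>u\<in>born L N t \<omega>. length u < m"
      unfolding finite_nat_set_iff_bounded by auto
    then have m: "\<not> (\<exists>u\<in>born L N t \<omega>. n \<le> length u)" if "n \<ge> m" for n
      using that by force
    have "V n = v" if "n \<ge> m" for n
      using m[OF that] True s unfolding V v_def
      by (simp add: population_def gpow_def ex ennreal_power)
    then show ?thesis unfolding eventually_sequentially by blast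
  next
    case False
    then have "\<exists>u\<in>born L N t \<omega>. n \<le> length u" for n
      using fin[of n] by (force simp: not_le)
    then have "V n = v" for n
      using False unfolding V v_def by (simp add: population_def gpow_def ex)
    then show ?thesis by simp
  qed
  then have "V \<longlonglongrightarrow> v" by (rule tendsto_eventually)
  moreover have "incseq V"
    unfolding V_def by (rule incseq_SucI) (rule trunc_gf_mono)
  then have "V \<longlonglongrightarrow> (SUP n. V n)" by (rule LIMSEQ_SUP)
  ultimately show ?thesis unfolding V_def v_def using LIMSEQ_unique by blast
qed

section \<open>Measurability and the backward recursion\<close>

abbreviation mark_space :: "(real \<times> nat option) measure" where
  "mark_space \<equiv> borel \<Otimes>\<^sub>M count_space UNIV"

lemma measurable_subtree:
  "(\<lambda>x w. x (w @ [i])) \<in> (\<Pi>\<^sub>M u\<in>UNIV. mark_space) \<rightarrow>\<^sub>M (\<Pi>\<^sub>M u\<in>(UNIV :: nat list set). mark_space)"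
  by (rule measurable_PiM_single') (auto simp: space_PiM)

text \<open>Joint measurability in time and marks, because the recursion evaluates the subtrees at
  the random time t - fst (x []).\<close>

lemma measurable_trunc_gf:
  "(\<lambda>(t, x). trunc_gf s n t x) \<in> borel_measurable (borel \<Otimes>\<^sub>M (\<Pi>\<^sub>M u\<in>UNIV. mark_space))"
proof (induction n)
  case (Suc n)
  note measurable_subtree[measurable]
  have [measurable]: "(\<lambda>z. trunc_gf s n (fst z) (snd z)) \<in> borel_measurable (borel \<Otimes>\<^sub>M (\<Pi>\<^sub>M u\<in>UNIV. mark_space))"
    using Suc by (simp add: case_prod_unfold)
  have [measurable]: "(\<lambda>z. trunc_gf s n (fst z - fst (snd z [])) (\<lambda>w. snd z (w @ [i])))
      \<in> borel_measurable (borel \<Otimes>\<^sub>M (\<Pi>\<^sub>M u\<in>UNIV. mark_space))" for i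
  proof -
    have "(\<lambda>z. (fst z - fst (snd z []), (\<lambda>w. snd z (w @ [i])))) \<in>
        borel \<Otimes>\<^sub>M (\<Pi>\<^sub>M u\<in>UNIV. mark_space) \<rightarrow>\<^sub>M borel \<Otimes>\<^sub>M (\<Pi>\<^sub>M u\<in>UNIV. mark_space)"
      by (rule measurable_Pair) measurable
    from measurable_compose[OF this Suc] show ?thesis by simp
  qed
  \<comment> \<open>The number of factors is random; fixing one of the countably many outcomes c
    makes it constant.\<close>
  have "(\<lambda>z. (\<lambda>c z. if fst z < fst (snd z []) then s else
      (case c of None \<Rightarrow> 0 | Some k \<Rightarrow> \<Prod>i<k. trunc_gf s n (fst z - fst (snd z [])) (\<lambda>w. snd z (w @ [i]))))
      (snd (snd z [])) z) \<in> borel_measurable (borel \<Otimes>\<^sub>M (\<Pi>\<^sub>M u\<in>UNIV. mark_space))"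
  proof (rule measurable_compose_countable)
    fix c :: "nat option"
    show "(\<lambda>z. if fst z < fst (snd z []) then s else
      (case c of None \<Rightarrow> 0 | Some k \<Rightarrow> \<Prod>i<k. trunc_gf s n (fst z - fst (snd z [])) (\<lambda>w. snd z (w @ [i]))))
      \<in> borel_measurable (borel \<Otimes>\<^sub>M (\<Pi>\<^sub>M u\<in>UNIV. mark_space))"
    proof (cases c)
      case None
      show ?thesis unfolding None option.case by measurable
    next
      case (Some k)
      show ?thesis unfolding Some option.case by measurable
    qed
  qed measurable
  then show ?case by (simp add: case_prod_unfold)
qed simp

text \<open>The expectation of \<^const>\<open>trunc_gf\<close>, given by conditioning on the first death.\<close>

primrec gen_gf :: "(nat \<Rightarrow> real) \<Rightarrow> ennreal \<Rightarrow> nat \<Rightarrow> real \<Rightarrow> ennreal" where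
  "gen_gf p s 0 t = 0"
| "gen_gf p s (Suc n) t = (\<integral>\<^sup>+ l. ennreal (exponential_density 1 l) *
     (if t < l then s else (\<Sum>k. ennreal (p k) * gen_gf p s n (t - l) ^ k)) \<partial>lborel)"

lemma measurable_gen_gf [measurable]: "gen_gf p s n \<in> borel_measurable borel"
proof (induction n)
  case (Suc n)
  note [measurable] = Suc
  show ?case unfolding gen_gf.simps by measurable
qed simp

context branching_particles
begin

lemma measurable_marks: "(\<lambda>\<omega>. (L u \<omega>, N u \<omega>)) \<in> M \<rightarrow>\<^sub>M mark_space"
  using indep_particles unfolding indep_vars_def by blast

lemma measurable_L [measurable]: "L u \<in> borel_measurable M"
proof -
  have "fst \<circ> (\<lambda>\<omega>. (L u \<omega>, N u \<omega>)) \<in> borel_measurable M"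
    by (rule measurable_comp[OF measurable_marks measurable_fst])
  then show ?thesis by (simp only: o_def fst_conv)
qed

lemma measurable_N [measurable]: "N u \<in> M \<rightarrow>\<^sub>M count_space UNIV"
proof -
  have "snd \<circ> (\<lambda>\<omega>. (L u \<omega>, N u \<omega>)) \<in> M \<rightarrow>\<^sub>M count_space UNIV"
    by (rule measurable_comp[OF measurable_marks measurable_snd])
  then show ?thesis by (simp only: o_def snd_conv)
qed

lemma AE_L_nonneg: "AE \<omega> in M. \<forall>u. 0 \<le> L u \<omega>"
proof -
  have "AE \<omega> in M. 0 \<le> L u \<omega>" for u
  proof -
    have "AE l in density lborel (exponential_density 1). 0 \<le> l"
      by (subst AE_density) (auto simp: exponential_density_def)
    then have "AE l in distr M lborel (L u). 0 \<le> l"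
      by (simp only: distributed_distr_eq_density[OF life_length])
    moreover have "L u \<in> M \<rightarrow>\<^sub>M lborel"
      by (subst measurable_cong_sets[OF refl sets_lborel]) (rule measurable_L)
    moreover have "{l \<in> space lborel. 0 \<le> (l :: real)} \<in> sets lborel" by measurable
    ultimately show ?thesis by (simp only: AE_distr_iff)
  qed
  then show ?thesis by (simp only: AE_all_countable simp_thms)
qed

text \<open>The branching property: each child of the ancestor starts a copy of the whole family.
  Independence survives the relabelling since the blocks {u @ [i]} are disjoint.\<close>

lemma branching_particles_subtree:
  "branching_particles M p (\<lambda>u. L (u @ [i])) (\<lambda>u. N (u @ [i]))"
proof
  have "indep_vars (\<lambda>u. \<Pi>\<^sub>M v\<in>{u @ [i]}. mark_space)
      (\<lambda>u \<omega>. restrict (\<lambda>v. (L v \<omega>, N v \<omega>)) {u @ [i]}) UNIV"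
    by (rule indep_vars_restrict[OF indep_particles]) (auto simp: disjoint_family_on_def)
  from indep_vars_compose2[OF this, of "\<lambda>u x. x (u @ [i])" "\<lambda>_. mark_space"]
  show "indep_vars (\<lambda>_. mark_space) (\<lambda>u \<omega>. (L (u @ [i]) \<omega>, N (u @ [i]) \<omega>)) UNIV"
    by simp
qed (use life_length offspring_number graveyard indep_life_offspring in auto)

lemma nn_integral_offspring:
  assumes [simp]: "f None = 0"
  shows "(\<integral>\<^sup>+ z. f z \<partial>distr M (count_space UNIV) (N u)) = (\<Sum>k. ennreal (p k) * f (Some k))"
proof -
  let ?K = "distr M (count_space UNIV) (N u)"
  have expand: "f z = (\<Sum>k. f (Some k) * indicator {Some k} z)" for z
  proof (cases z)
    case (Some j)
    have "(\<Sum>k. f (Some k) * indicator {Some k} z) = f (Some j)"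
      by (rule suminf_cmult_indicator) (auto simp: disjoint_family_on_def Some)
    then show ?thesis using Some by simp
  qed simp
  have "(\<integral>\<^sup>+ z. f z \<partial>?K) = (\<integral>\<^sup>+ z. (\<Sum>k. f (Some k) * indicator {Some k} z) \<partial>?K)"
    by (rule nn_integral_cong) (rule expand)
  also have "\<dots> = (\<Sum>k. f (Some k) * emeasure ?K {Some k})"
    by (subst nn_integral_suminf) (simp_all add: nn_integral_cmult_indicator)
  finally have "(\<integral>\<^sup>+ z. f z \<partial>?K) = (\<Sum>k. f (Some k) * emeasure ?K {Some k})" .
  moreover have "emeasure ?K {Some k} = ennreal (p k)" for k
  proof -
    have "emeasure ?K {Some k} = emeasure M {\<omega> \<in> space M. N u \<omega> = Some k}"
      by (subst emeasure_distr) (auto intro!: arg_cong[where f = "emeasure M"])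
    then show ?thesis by (simp add: emeasure_eq_measure offspring_number)
  qed
  ultimately show ?thesis by (simp add: mult.commute)
qed

text \<open>An ancestor alive at t contributes s whatever its future outcome, \<open>None\<close>
  included; the outcome is summed over only for l <= t, where \<open>None\<close> contributes
  0.\<close>

lemma nn_integral_first_mark:
  assumes f [measurable]: "f \<in> borel_measurable mark_space" and f0: "\<And>l. l \<le> t \<Longrightarrow> f (l, None) = 0"
    and s: "\<And>l z. t < l \<Longrightarrow> f (l, z) = s"
  shows "(\<integral>\<^sup>+ \<omega>. f (L u \<omega>, N u \<omega>) \<partial>M) =
    (\<integral>\<^sup>+ l. ennreal (exponential_density 1 l) *
       (if t < l then s else (\<Sum>k. ennreal (p k) * f (l, Some k))) \<partial>lborel)"
proof -
  let ?E = "distr M borel (L u)" and ?K = "distr M (count_space UNIV) (N u)"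
  interpret K: prob_space ?K by (rule prob_space_distr) simp
  have "(\<integral>\<^sup>+ \<omega>. f (L u \<omega>, N u \<omega>) \<partial>M) = (\<integral>\<^sup>+ z. f z \<partial>distr M mark_space (\<lambda>\<omega>. (L u \<omega>, N u \<omega>)))"
    by (subst nn_integral_distr) auto
  also have "\<dots> = (\<integral>\<^sup>+ z. f z \<partial>(?E \<Otimes>\<^sub>M ?K))" by (simp add: indep_life_offspring)
  also have "\<dots> = (\<integral>\<^sup>+ l. \<integral>\<^sup>+ z. f (l, z) \<partial>?K \<partial>?E)"
    by (subst K.nn_integral_fst[symmetric]) (auto cong: measurable_cong_sets)
  also have "\<dots> = (\<integral>\<^sup>+ l. (if t < l then s else (\<Sum>k. ennreal (p k) * f (l, Some k))) \<partial>?E)"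
  proof (intro nn_integral_cong)
    fix l
    show "(\<integral>\<^sup>+ z. f (l, z) \<partial>?K) = (if t < l then s else (\<Sum>k. ennreal (p k) * f (l, Some k)))"
      using f0[of l] s[of l] K.emeasure_space_1 nn_integral_offspring[of "\<lambda>z. f (l, z)"] by auto
  qed
  also have "?E = distr M lborel (L u)" by (rule distr_cong) auto
  also have "\<dots> = density lborel (exponential_density 1)"
    by (rule distributed_distr_eq_density[OF life_length])
  finally show ?thesis
    by (subst (asm) nn_integral_density) auto
qed

end

lemma (in prob_space) nn_integral_indep_pair:
  assumes ind: "indep_var S X T Y" and f [measurable]: "(\<lambda>(x, y). f x y) \<in> borel_measurable (S \<Otimes>\<^sub>M T)"
  shows "(\<integral>\<^sup>+ \<omega>. f (X \<omega>) (Y \<omega>) \<partial>M) = (\<integral>\<^sup>+ \<omega>. \<integral>\<^sup>+ \<omega>'. f (X \<omega>) (Y \<omega>') \<partial>M \<partial>M)"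
proof -
  have [measurable]: "X \<in> M \<rightarrow>\<^sub>M S" "Y \<in> M \<rightarrow>\<^sub>M T"
    and d: "distr M (S \<Otimes>\<^sub>M T) (\<lambda>\<omega>. (X \<omega>, Y \<omega>)) = distr M S X \<Otimes>\<^sub>M distr M T Y"
    using ind by (auto simp: indep_var_distribution_eq)
  interpret Y: prob_space "distr M T Y" by (rule prob_space_distr) simp
  have "(\<integral>\<^sup>+ \<omega>. f (X \<omega>) (Y \<omega>) \<partial>M) = (\<integral>\<^sup>+ z. (case z of (x, y) \<Rightarrow> f x y) \<partial>distr M (S \<Otimes>\<^sub>M T) (\<lambda>\<omega>. (X \<omega>, Y \<omega>)))"
    by (subst nn_integral_distr) auto
  also have "\<dots> = (\<integral>\<^sup>+ x. \<integral>\<^sup>+ y. f x y \<partial>distr M T Y \<partial>distr M S X)"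
    unfolding d by (subst Y.nn_integral_fst[symmetric]) (auto cong: measurable_cong_sets)
  also have "\<dots> = (\<integral>\<^sup>+ \<omega>. \<integral>\<^sup>+ y. f (X \<omega>) y \<partial>distr M T Y \<partial>M)"
    by (subst nn_integral_distr) auto
  also have "\<dots> = (\<integral>\<^sup>+ \<omega>. \<integral>\<^sup>+ \<omega>'. f (X \<omega>) (Y \<omega>') \<partial>M \<partial>M)"
  proof (rule nn_integral_cong)
    fix \<omega> assume "\<omega> \<in> space M"
    then have [simp]: "X \<omega> \<in> space S" by (rule measurable_space[rotated]) simp
    show "(\<integral>\<^sup>+ y. f (X \<omega>) y \<partial>distr M T Y) = (\<integral>\<^sup>+ \<omega>'. f (X \<omega>) (Y \<omega>') \<partial>M)"
      by (subst nn_integral_distr) auto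
  qed
  finally show ?thesis .
qed

text \<open>The induction runs over all families at once, so that it applies to subtrees.
  Independence is used twice: between the ancestor's mark and all others, and between the subtrees,
  which use disjoint sets of labels.\<close>

lemma nn_integral_trunc_gf:
  assumes "branching_particles M p L N"
  shows "(\<integral>\<^sup>+ \<omega>. trunc_gf s n t (\<lambda>u. (L u \<omega>, N u \<omega>)) \<partial>M) = gen_gf p s n t"
  using assms
proof (induction n arbitrary: L N t)
  case (Suc n)
  interpret branching_particles M p L N by fact
  define X where "X u \<omega> = (L u \<omega>, N u \<omega>)" for u \<omega>
  have X: "indep_vars (\<lambda>_. mark_space) X UNIV"
    using indep_particles by (simp add: X_def[abs_def])
  let ?R = "{[] :: nat list}" and ?C = "- {[] :: nat list}"
  have ind: "indep_var (\<Pi>\<^sub>M u\<in>?R. mark_space) (\<lambda>\<omega>. restrict (\<lambda>u. X u \<omega>) ?R)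
      (\<Pi>\<^sub>M u\<in>?C. mark_space) (\<lambda>\<omega>. restrict (\<lambda>u. X u \<omega>) ?C)"
    by (rule indep_var_restrict[OF X]) auto
  define H where "H c l y = (if t < l then s else case c of None \<Rightarrow> 0
      | Some k \<Rightarrow> \<Prod>i<k. trunc_gf s n (t - l) (\<lambda>w. y (w @ [i])))" for c l y
  have sub: "(\<lambda>y w. y (w @ [i])) \<in> (\<Pi>\<^sub>M u\<in>A. mark_space) \<rightarrow>\<^sub>M (\<Pi>\<^sub>M u\<in>(UNIV :: nat list set). mark_space)"
    if "range (\<lambda>w. w @ [i]) \<subseteq> A" for i A
    by (rule measurable_PiM_single') (use that in \<open>auto simp: space_PiM intro!: measurable_component_singleton\<close>)
  have H: "(\<lambda>(x, y). H (snd (x [])) (fst (x [])) y) \<in>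
      borel_measurable ((\<Pi>\<^sub>M u\<in>?R. mark_space) \<Otimes>\<^sub>M (\<Pi>\<^sub>M u\<in>?C. mark_space))"
    unfolding case_prod_unfold
  proof (rule measurable_compose_countable[where f = "\<lambda>c z. H c (fst (fst z [])) (snd z)"
      and g = "\<lambda>z. snd (fst z [])"])
    have [measurable]: "(\<lambda>x. x []) \<in> (\<Pi>\<^sub>M u\<in>?R. mark_space) \<rightarrow>\<^sub>M mark_space"
      by (rule measurable_component_singleton) simp
    show "(\<lambda>z. snd (fst z [])) \<in> (\<Pi>\<^sub>M u\<in>?R. mark_space) \<Otimes>\<^sub>M (\<Pi>\<^sub>M u\<in>?C. mark_space) \<rightarrow>\<^sub>M count_space UNIV"
      by measurable
    have [measurable]: "(\<lambda>z. trunc_gf s n (t - fst (fst z [])) (\<lambda>w. snd z (w @ [i]))) \<in>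
        borel_measurable ((\<Pi>\<^sub>M u\<in>?R. mark_space) \<Otimes>\<^sub>M (\<Pi>\<^sub>M u\<in>?C. mark_space))" for i
    proof -
      have [measurable]: "(\<lambda>y w. y (w @ [i])) \<in> (\<Pi>\<^sub>M u\<in>?C. mark_space) \<rightarrow>\<^sub>M (\<Pi>\<^sub>M u\<in>(UNIV :: nat list set). mark_space)"
        by (rule sub) auto
      have "(\<lambda>z. (t - fst (fst z []), (\<lambda>w. snd z (w @ [i])))) \<in>
          (\<Pi>\<^sub>M u\<in>?R. mark_space) \<Otimes>\<^sub>M (\<Pi>\<^sub>M u\<in>?C. mark_space) \<rightarrow>\<^sub>M borel \<Otimes>\<^sub>M (\<Pi>\<^sub>M u\<in>UNIV. mark_space)"
        by (rule measurable_Pair) measurable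
      from measurable_compose[OF this measurable_trunc_gf] show ?thesis by simp
    qed
    fix c :: "nat option"
    show "(\<lambda>z. H c (fst (fst z [])) (snd z)) \<in>
        borel_measurable ((\<Pi>\<^sub>M u\<in>?R. mark_space) \<Otimes>\<^sub>M (\<Pi>\<^sub>M u\<in>?C. mark_space))"
    proof (cases c)
      case None
      show ?thesis unfolding H_def None option.case by measurable
    next
      case (Some k)
      show ?thesis unfolding H_def Some option.case by measurable
    qed
  qed
  have inner: "(\<integral>\<^sup>+ \<omega>'. H (N [] \<omega>) (L [] \<omega>) (\<lambda>u. X u \<omega>') \<partial>M) =
      (if t < L [] \<omega> then s else case N [] \<omega> of None \<Rightarrow> 0
        | Some k \<Rightarrow> gen_gf p s n (t - L [] \<omega>) ^ k)" for \<omega>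
  proof (cases "t < L [] \<omega> \<or> N [] \<omega> = None")
    case True
    then show ?thesis by (auto simp: H_def emeasure_space_1)
  next
    case False
    then obtain k where k: "N [] \<omega> = Some k" "\<not> t < L [] \<omega>" by auto
    define \<tau> where "\<tau> = t - L [] \<omega>"
    let ?K = "\<lambda>i. range (\<lambda>w :: nat list. w @ [i :: nat])"
    have m: "(\<lambda>y. trunc_gf s n \<tau> (\<lambda>w. y (w @ [i]))) \<in> borel_measurable (\<Pi>\<^sub>M u\<in>?K i. mark_space)" for i
    proof -
      have "(\<lambda>y. (\<tau>, (\<lambda>w. y (w @ [i])))) \<in> (\<Pi>\<^sub>M u\<in>?K i. mark_space) \<rightarrow>\<^sub>M borel \<Otimes>\<^sub>M (\<Pi>\<^sub>M u\<in>UNIV. mark_space)"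
        by (rule measurable_Pair[OF _ sub]) auto
      from measurable_compose[OF this measurable_trunc_gf] show ?thesis by simp
    qed
    have "indep_vars (\<lambda>i. \<Pi>\<^sub>M u\<in>?K i. mark_space) (\<lambda>i \<omega>. restrict (\<lambda>u. X u \<omega>) (?K i)) {..<k}"
      by (rule indep_vars_restrict[OF X]) (auto simp: disjoint_family_on_def)
    from indep_vars_compose2[OF this, of "\<lambda>i y. trunc_gf s n \<tau> (\<lambda>w. y (w @ [i]))" "\<lambda>_. borel", OF m]
    have "indep_vars (\<lambda>_. borel) (\<lambda>i \<omega>. trunc_gf s n \<tau> (\<lambda>w. X (w @ [i]) \<omega>)) {..<k}"
      by simp
    from indep_vars_nn_integral[OF _ this]
    have "(\<integral>\<^sup>+ \<omega>'. H (N [] \<omega>) (L [] \<omega>) (\<lambda>u. X u \<omega>') \<partial>M) =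
        (\<Prod>i<k. \<integral>\<^sup>+ \<omega>'. trunc_gf s n \<tau> (\<lambda>w. X (w @ [i]) \<omega>') \<partial>M)"
      using k by (simp add: H_def \<tau>_def)
    also have "\<dots> = (\<Prod>i<k. gen_gf p s n \<tau>)"
      unfolding X_def by (intro prod.cong refl Suc.IH branching_particles_subtree)
    finally show ?thesis using k by (simp add: \<tau>_def)
  qed
  \<comment> \<open>\<open>H\<close> reads its last argument only at labels w @ [i], never at [], so
    restricting to the complement of [] changes nothing.\<close>
  have "(\<integral>\<^sup>+ \<omega>. trunc_gf s (Suc n) t (\<lambda>u. (L u \<omega>, N u \<omega>)) \<partial>M) =
      (\<integral>\<^sup>+ \<omega>. H (snd (restrict (\<lambda>u. X u \<omega>) ?R [])) (fst (restrict (\<lambda>u. X u \<omega>) ?R []))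
        (restrict (\<lambda>u. X u \<omega>) ?C) \<partial>M)"
    by (simp add: H_def X_def cong: option.case_cong if_cong)
  also have "\<dots> = (\<integral>\<^sup>+ \<omega>. \<integral>\<^sup>+ \<omega>'. H (snd (restrict (\<lambda>u. X u \<omega>) ?R [])) (fst (restrict (\<lambda>u. X u \<omega>) ?R []))
        (restrict (\<lambda>u. X u \<omega>') ?C) \<partial>M \<partial>M)"
    by (rule nn_integral_indep_pair[OF ind H])
  also have "\<dots> = (\<integral>\<^sup>+ \<omega>. \<integral>\<^sup>+ \<omega>'. H (N [] \<omega>) (L [] \<omega>) (\<lambda>u. X u \<omega>') \<partial>M \<partial>M)"
    by (simp add: H_def X_def cong: option.case_cong if_cong)
  also have "\<dots> = (\<integral>\<^sup>+ \<omega>. (\<lambda>(l, z). if t < l then s else case z of None \<Rightarrow> 0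
        | Some k \<Rightarrow> gen_gf p s n (t - l) ^ k) (L [] \<omega>, N [] \<omega>) \<partial>M)"
    unfolding inner by simp
  also have "\<dots> = gen_gf p s (Suc n) t"
  proof (subst nn_integral_first_mark[where t = t and s = s])
    show "(\<lambda>(l, z). if t < l then s else case z of None \<Rightarrow> 0 | Some k \<Rightarrow> gen_gf p s n (t - l) ^ k)
        \<in> borel_measurable mark_space"
      unfolding case_prod_unfold
    proof (rule measurable_compose_countable[where g = snd and f = "\<lambda>c x. if t < fst x then s
          else case c of None \<Rightarrow> 0 | Some k \<Rightarrow> gen_gf p s n (t - fst x) ^ k"])
      fix c :: "nat option"
      show "(\<lambda>x. if t < fst x then s else case c of None \<Rightarrow> 0 | Some k \<Rightarrow> gen_gf p s n (t - fst x) ^ k)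
          \<in> borel_measurable mark_space"
      proof (cases c)
        case None
        show ?thesis unfolding None option.case by measurable
      next
        case (Some k)
        show ?thesis unfolding Some option.case by measurable
      qed
    qed measurable
  qed (auto intro!: nn_integral_cong)
  finally show ?case .
qed simp

section \<open>The generating function of the process\<close>

text \<open>Only quantifiers over countable types occur on the right, which makes the explosion
  event measurable.\<close>

lemma infinite_countable_iff:
  fixes A :: "'b :: countable set"
  shows "infinite A \<longleftrightarrow> (\<forall>m. \<exists>u. m \<le> to_nat u \<and> u \<in> A)"
proof -
  have "finite (to_nat ` A) \<longleftrightarrow> finite A"
    by (rule finite_image_iff) (auto intro: inj_on_subset[OF inj_to_nat])
  moreover have "(\<forall>m. \<exists>n\<ge>m. n \<in> to_nat ` A) \<longleftrightarrow> (\<forall>m. \<exists>u. m \<le> to_nat u \<and> u \<in> A)" by blast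
  ultimately show ?thesis
    using infinite_nat_iff_unbounded_le[of "to_nat ` A"] by simp
qed

text \<open>Enumerating lists instead of sets keep the quantifier countable, with the same purpose
  for the number of living particles.\<close>

lemma finite_card_eq_iff:
  "finite A \<and> card A = k \<longleftrightarrow> (\<exists>xs. distinct xs \<and> length xs = k \<and> (\<forall>u. u \<in> set xs \<longleftrightarrow> u \<in> A))"
proof
  assume "finite A \<and> card A = k"
  then obtain xs where "set xs = A" "distinct xs" using finite_distinct_list by auto
  with \<open>finite A \<and> card A = k\<close> show "\<exists>xs. distinct xs \<and> length xs = k \<and> (\<forall>u. u \<in> set xs \<longleftrightarrow> u \<in> A)"
    by (intro exI[of _ xs]) (auto simp: distinct_card)
next
  assume "\<exists>xs. distinct xs \<and> length xs = k \<and> (\<forall>u. u \<in> set xs \<longleftrightarrow> u \<in> A)"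
  then obtain xs where xs: "distinct xs" "length xs = k" "\<forall>u. u \<in> set xs \<longleftrightarrow> u \<in> A" by blast
  then have "A = set xs" by blast
  then show "finite A \<and> card A = k" using xs by (simp add: distinct_card)
qed

context branching_particles
begin

lemma pred_realised [measurable]: "Measurable.pred M (\<lambda>\<omega>. realised N \<omega> u)"
proof (induction u)
  case (Cons i u)
  note [measurable] = Cons
  have "Measurable.pred M (\<lambda>\<omega>. (\<lambda>z. \<exists>k. z = Some k \<and> i < k) (N u \<omega>))"
    by (rule measurable_compose[OF measurable_N]) simp
  then show ?case unfolding realised.simps by (intro pred_intros_logic Cons)
qed simp

lemma measurable_birth_time [measurable]: "(\<lambda>\<omega>. birth_time L \<omega> u) \<in> borel_measurable M"
proof (induction u)
  case (Cons i u)
  note [measurable] = Cons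
  show ?case unfolding birth_time.simps by measurable
qed simp

lemma measurable_death_time [measurable]: "(\<lambda>\<omega>. death_time L \<omega> u) \<in> borel_measurable M"
  unfolding death_time_def by measurable

text \<open>
  The space is not assumed complete, so agreeing almost everywhere with a supremum of measurable
  functions would not make the population measurable, as the integrability claim needs.
\<close>

lemma measurable_population: "population L N t \<in> M \<rightarrow>\<^sub>M count_space UNIV"
proof -
  have [measurable]: "Measurable.pred M (\<lambda>\<omega>. N u \<omega> = None)" for u
    by measurable
  have k [measurable]: "Measurable.pred M (\<lambda>\<omega>. killed L N t \<omega>)"
    unfolding killed_def by measurable
  have e [measurable]: "Measurable.pred M (\<lambda>\<omega>. exploded L N t \<omega>)"
    unfolding exploded_def infinite_countable_iff mem_Collect_eq by measurable
  have c: "Measurable.pred M (\<lambda>\<omega>. finite (alive L N t \<omega>) \<and> card (alive L N t \<omega>) = j)" for j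
    unfolding finite_card_eq_iff alive_def mem_Collect_eq by measurable
  have "{\<omega> \<in> space M. population L N t \<omega> = z} \<in> events" for z
  proof (cases z)
    case None
    have "Measurable.pred M (\<lambda>\<omega>. killed L N t \<omega> \<or> exploded L N t \<omega>)"
      by measurable
    moreover have "population L N t \<omega> = z \<longleftrightarrow> killed L N t \<omega> \<or> exploded L N t \<omega>" for \<omega>
      by (simp add: population_def None)
    ultimately show ?thesis by (simp only: pred_def)
  next
    case (Some j)
    \<comment> \<open>\<open>card\<close> is 0 on infinite sets; finiteness in the absence of
      explosion rules out a spurious population of 0.\<close>
    have "finite (alive L N t \<omega>)" if "\<not> exploded L N t \<omega>" for \<omega>
      by (rule finite_subset[of _ "{u. realised N \<omega> u \<and> birth_time L \<omega> u \<le> t}"])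
        (use that in \<open>auto simp: alive_def exploded_def\<close>)
    then have "population L N t \<omega> = z \<longleftrightarrow> \<not> killed L N t \<omega> \<and> \<not> exploded L N t \<omega> \<and>
        (finite (alive L N t \<omega>) \<and> card (alive L N t \<omega>) = j)" for \<omega>
      by (auto simp: population_def Some)
    moreover have "Measurable.pred M (\<lambda>\<omega>. \<not> killed L N t \<omega> \<and> \<not> exploded L N t \<omega> \<and>
        (finite (alive L N t \<omega>) \<and> card (alive L N t \<omega>) = j))"
      by (intro pred_intros_logic k e c)
    ultimately show ?thesis by (simp only: pred_def)
  qed
  moreover have "population L N t -` {z} \<inter> space M = {\<omega> \<in> space M. population L N t \<omega> = z}" for z
    by auto
  ultimately show ?thesis
    by (subst measurable_count_space_eq2_countable) auto
qed

lemma measurable_gpow_population: "(\<lambda>\<omega>. gpow s (population L N t \<omega>)) \<in> borel_measurable M"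
  by (rule measurable_compose[OF measurable_population]) simp

lemma measurable_trunc_gf_process: "(\<lambda>\<omega>. trunc_gf s n t (\<lambda>u. (L u \<omega>, N u \<omega>))) \<in> borel_measurable M"
proof -
  have "(\<lambda>\<omega> u. (L u \<omega>, N u \<omega>)) \<in> M \<rightarrow>\<^sub>M (\<Pi>\<^sub>M u\<in>UNIV. mark_space)"
    by (rule measurable_PiM_single'[OF measurable_marks]) (auto simp: space_pair_measure)
  then have "(\<lambda>\<omega>. (t, \<lambda>u. (L u \<omega>, N u \<omega>))) \<in> M \<rightarrow>\<^sub>M borel \<Otimes>\<^sub>M (\<Pi>\<^sub>M u\<in>UNIV. mark_space)"
    by (intro measurable_Pair) simp
  from measurable_compose[OF this measurable_trunc_gf] show ?thesis by simp
qed

lemma incseq_gen_gf: "incseq (\<lambda>n. gen_gf p s n t)"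
  unfolding nn_integral_trunc_gf[OF branching_particles_axioms, symmetric]
  by (rule incseq_SucI, rule nn_integral_mono, rule trunc_gf_mono)

lemma nn_integral_gpow_population:
  assumes "0 \<le> t" "0 \<le> s"
  shows "(\<integral>\<^sup>+ \<omega>. ennreal (gpow s (population L N t \<omega>)) \<partial>M) = (SUP n. gen_gf p (ennreal s) n t)"
proof -
  have "(\<integral>\<^sup>+ \<omega>. ennreal (gpow s (population L N t \<omega>)) \<partial>M) =
      (\<integral>\<^sup>+ \<omega>. (SUP n. trunc_gf (ennreal s) n t (\<lambda>u. (L u \<omega>, N u \<omega>))) \<partial>M)"
  proof (rule nn_integral_cong_AE)
    show "AE \<omega> in M. ennreal (gpow s (population L N t \<omega>)) =
        (SUP n. trunc_gf (ennreal s) n t (\<lambda>u. (L u \<omega>, N u \<omega>)))"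
      using AE_L_nonneg
    proof (rule AE_mp, intro AE_I2 impI)
      fix \<omega> assume "\<forall>u. 0 \<le> L u \<omega>"
      then show "ennreal (gpow s (population L N t \<omega>)) =
          (SUP n. trunc_gf (ennreal s) n t (\<lambda>u. (L u \<omega>, N u \<omega>)))"
        by (intro SUP_trunc_gf[symmetric] assms) blast
    qed
  qed
  also have "\<dots> = (SUP n. \<integral>\<^sup>+ \<omega>. trunc_gf (ennreal s) n t (\<lambda>u. (L u \<omega>, N u \<omega>)) \<partial>M)"
    by (rule nn_integral_monotone_convergence_SUP)
      (auto intro!: incseq_SucI le_funI trunc_gf_mono measurable_trunc_gf_process simp del: trunc_gf.simps)
  finally show ?thesis
    unfolding nn_integral_trunc_gf[OF branching_particles_axioms] .
qed

end

section \<open>From the recursion to the backward differential equation\<close>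

lemma nn_integral_exponential_density: "(\<integral>\<^sup>+ l. ennreal (exponential_density 1 l) \<partial>lborel) = 1"
proof -
  interpret prob_space "density lborel (exponential_density 1)"
    by (rule prob_space_exponential_density) simp
  show ?thesis using emeasure_space_1 by (simp add: emeasure_density)
qed

lemma exponential_density_1_nonneg: "0 \<le> exponential_density 1 l"
  by (simp add: exponential_density_def)

lemma integrable_exponential_density: "integrable lborel (exponential_density 1)"
  by (rule integrableI_nonneg)
    (simp_all add: nn_integral_exponential_density exponential_density_1_nonneg)

lemma integral_exponential_density: "(\<integral>l. exponential_density 1 l \<partial>lborel) = 1"
  by (subst integral_eq_nn_integral)
    (simp_all add: nn_integral_exponential_density exponential_density_1_nonneg)

text \<open>Common ground of both cases: a fixed point r of f with s <= r, where r = 1 in the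
  critical case.\<close>

locale branching_gf = branching_particles +
  fixes r s :: real
  assumes p_nonneg: "\<And>k. 0 \<le> p k" and fix_r: "(\<lambda>k. p k * r ^ k) sums r"
    and s: "0 \<le> s" "s \<le> r" and cont: "continuous_on {0..r} (gf p)"
begin

lemma gf_sums: "0 \<le> x \<Longrightarrow> x \<le> r \<Longrightarrow> (\<lambda>k. p k * x ^ k) sums gf p x"
  unfolding gf_def
  by (rule summable_sums, cases "x = r")
    (use fix_r in \<open>auto simp: sums_iff intro: powser_inside[of p r x]\<close>)

lemma gf_bounds: "0 \<le> x \<Longrightarrow> x \<le> r \<Longrightarrow> 0 \<le> gf p x \<and> gf p x \<le> r"
proof -
  assume x: "0 \<le> x" "x \<le> r"
  have "0 \<le> gf p x"
    by (rule sums_le[OF _ sums_zero gf_sums[OF x]]) (use p_nonneg x in auto)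
  moreover have "gf p x \<le> r"
    by (rule sums_le[OF _ gf_sums[OF x] fix_r]) (use p_nonneg x in \<open>auto intro!: mult_left_mono power_mono\<close>)
  ultimately show ?thesis by simp
qed

lemma suminf_ennreal_gf:
  assumes "0 \<le> x" "x \<le> r"
  shows "(\<Sum>k. ennreal (p k) * ennreal x ^ k) = ennreal (gf p x)"
proof -
  have "(\<Sum>k. ennreal (p k * x ^ k)) = ennreal (\<Sum>k. p k * x ^ k)"
    by (rule suminf_ennreal2) (use assms p_nonneg gf_sums in \<open>auto simp: sums_iff\<close>)
  then show ?thesis
    using assms p_nonneg by (simp add: gf_def ennreal_mult ennreal_power)
qed

text \<open>The constant r is reproduced by the recursion because f(r) = r, hence it bounds every
  iterate. For s > 1 this is what makes the expectation finite.\<close>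

lemma gen_gf_le: "gen_gf p (ennreal s) n t \<le> ennreal r"
proof (induction n arbitrary: t)
  case (Suc n)
  have le: "(\<Sum>k. ennreal (p k) * gen_gf p (ennreal s) n v ^ k) \<le> ennreal r" for v
  proof -
    have "(\<Sum>k. ennreal (p k) * gen_gf p (ennreal s) n v ^ k) \<le> (\<Sum>k. ennreal (p k) * ennreal r ^ k)"
      by (intro suminf_le mult_left_mono power_mono Suc) auto
    also have "\<dots> = ennreal (gf p r)" using s by (intro suminf_ennreal_gf) auto
    also have "gf p r = r" using fix_r by (simp add: gf_def sums_iff)
    finally show ?thesis .
  qed
  have "gen_gf p (ennreal s) (Suc n) t \<le> (\<integral>\<^sup>+ l. ennreal (exponential_density 1 l) * ennreal r \<partial>lborel)"
    unfolding gen_gf.simps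
    by (intro nn_integral_mono mult_left_mono) (use le s in \<open>auto intro: ennreal_leI\<close>)
  also have "\<dots> = ennreal r"
    by (subst nn_integral_multc) (auto simp: nn_integral_exponential_density)
  finally show ?case .
qed simp

definition y :: "nat \<Rightarrow> real \<Rightarrow> real" where "y n t = enn2real (gen_gf p (ennreal s) n t)"

definition Y :: "real \<Rightarrow> real" where "Y t = enn2real (SUP n. gen_gf p (ennreal s) n t)"

lemma SUP_gen_gf_le: "(SUP n. gen_gf p (ennreal s) n t) \<le> ennreal r"
  by (rule SUP_least) (rule gen_gf_le)

lemma ennreal_y: "gen_gf p (ennreal s) n t = ennreal (y n t)"
  unfolding y_def using le_less_trans[OF gen_gf_le ennreal_less_top] by simp

lemma y_bounds: "0 \<le> y n t" "y n t \<le> r"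
  using gen_gf_le[of n t] s by (simp_all add: y_def enn2real_leI)

lemma ennreal_Y: "(SUP n. gen_gf p (ennreal s) n t) = ennreal (Y t)"
  unfolding Y_def by (rule ennreal_enn2real[symmetric]) (rule le_less_trans[OF SUP_gen_gf_le ennreal_less_top])

lemma Y_bounds: "0 \<le> Y t" "Y t \<le> r"
  using SUP_gen_gf_le[of t] s by (simp_all add: Y_def enn2real_leI)

lemma process_gf_eq: "0 \<le> t \<Longrightarrow> integrable M (\<lambda>\<omega>. gpow s (population L N t \<omega>)) \<and> process_gf M L N t s = Y t"
proof -
  assume t: "0 \<le> t"
  have nn: "0 \<le> gpow s z" for z using s by (auto simp: gpow_def split: option.split)
  have *: "(\<integral>\<^sup>+ \<omega>. ennreal (gpow s (population L N t \<omega>)) \<partial>M) = ennreal (Y t)"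
    using nn_integral_gpow_population[OF t s(1)] ennreal_Y by simp
  have "integrable M (\<lambda>\<omega>. gpow s (population L N t \<omega>))"
    by (rule integrableI_nonneg[OF measurable_gpow_population]) (use nn * in auto)
  moreover have "process_gf M L N t s = Y t"
    unfolding process_gf_def
    by (subst integral_eq_nn_integral[OF measurable_gpow_population]) (use nn * Y_bounds in auto)
  ultimately show ?thesis ..
qed

lemma y_tendsto: "(\<lambda>n. y n t) \<longlonglongrightarrow> Y t"
proof -
  have "(\<lambda>n. gen_gf p (ennreal s) n t) \<longlonglongrightarrow> ennreal (Y t)"
    unfolding ennreal_Y[symmetric] by (rule LIMSEQ_SUP[OF incseq_gen_gf])
  then show ?thesis
    unfolding ennreal_y using y_bounds Y_bounds by (simp add: tendsto_ennreal_iff)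
qed

lemma measurable_y [measurable]: "y n \<in> borel_measurable borel"
  unfolding y_def by measurable

lemma measurable_Y [measurable]: "Y \<in> borel_measurable borel"
  unfolding Y_def by measurable

lemma measurable_gf [measurable]: "gf p \<in> borel_measurable borel"
  unfolding gf_def[abs_def] by measurable

lemma y_Suc: "y (Suc n) t = (\<integral>l. exponential_density 1 l * (if t < l then s else gf p (y n (t - l))) \<partial>lborel)"
proof -
  have nn: "0 \<le> exponential_density 1 l * (if t < l then s else gf p (y n (t - l)))" for l
    using gf_bounds[OF y_bounds] s by (auto simp: exponential_density_def)
  have "gen_gf p (ennreal s) (Suc n) t =
      (\<integral>\<^sup>+ l. ennreal (exponential_density 1 l * (if t < l then s else gf p (y n (t - l)))) \<partial>lborel)"
    unfolding gen_gf.simps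
  proof (intro nn_integral_cong)
    fix l
    show "ennreal (exponential_density 1 l) * (if t < l then ennreal s
        else \<Sum>k. ennreal (p k) * gen_gf p (ennreal s) n (t - l) ^ k) =
      ennreal (exponential_density 1 l * (if t < l then s else gf p (y n (t - l))))"
      unfolding ennreal_y suminf_ennreal_gf[OF y_bounds]
      using s gf_bounds[OF y_bounds] by (auto simp: ennreal_mult exponential_density_def)
  qed
  then show ?thesis
    by (subst integral_eq_nn_integral) (use nn in \<open>auto simp: y_def\<close>)
qed

text \<open>Dominated convergence in the recursion, with r times the density as majorant; continuity
  of f up to r carries the limit inside f.\<close>

lemma Y_renewal: "Y t = (\<integral>l. exponential_density 1 l * (if t < l then s else gf p (Y (t - l))) \<partial>lborel)"
proof (rule LIMSEQ_unique)
  show "(\<lambda>n. y (Suc n) t) \<longlonglongrightarrow> Y t" using y_tendsto by (rule LIMSEQ_Suc)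
  show "(\<lambda>n. y (Suc n) t) \<longlonglongrightarrow> (\<integral>l. exponential_density 1 l * (if t < l then s else gf p (Y (t - l))) \<partial>lborel)"
    unfolding y_Suc
  proof (rule integral_dominated_convergence[where w = "\<lambda>l. exponential_density 1 l * r"])
    show "integrable lborel (\<lambda>l. exponential_density 1 l * r)"
      using integrable_exponential_density by simp
    have "(\<lambda>n. gf p (y n v)) \<longlonglongrightarrow> gf p (Y v)" for v
      by (rule continuous_on_tendsto_compose[OF cont y_tendsto])
        (use y_bounds Y_bounds in auto)
    then show "AE l in lborel. (\<lambda>n. exponential_density 1 l * (if t < l then s else gf p (y n (t - l))))
        \<longlonglongrightarrow> exponential_density 1 l * (if t < l then s else gf p (Y (t - l)))"
      by (intro AE_I2 tendsto_mult_left) auto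
    show "AE l in lborel. norm (exponential_density 1 l * (if t < l then s else gf p (y n (t - l))))
        \<le> exponential_density 1 l * r" for n
      using s gf_bounds[OF y_bounds]
      by (intro AE_I2) (auto simp: exponential_density_def abs_mult)
  qed auto
qed

lemma Y_integral:
  assumes t: "0 \<le> t"
  shows "(\<lambda>v. exp v * gf p (Y v)) integrable_on {0..t}"
    and "Y t = exp (- t) * (s + integral {0..t} (\<lambda>v. exp v * gf p (Y v)))"
proof -
  let ?k = "\<lambda>v. exp v * gf p (Y v)"
  have S: "set_integrable lborel {0..t} ?k"
    unfolding set_integrable_def
  proof (rule Bochner_Integration.integrable_bound)
    show "integrable lborel (\<lambda>v. indicator {0..t} v *\<^sub>R (exp t * r))"
      by (intro integrable_scaleR_left integrable_real_indicator) (use t in auto)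
    show "AE v in lborel. norm (indicator {0..t} v *\<^sub>R ?k v) \<le> norm (indicator {0..t} v *\<^sub>R (exp t * r))"
      using gf_bounds[OF Y_bounds] s
      by (intro AE_I2) (auto simp: indicator_def abs_mult intro!: mult_mono)
  qed measurable
  show "?k integrable_on {0..t}" by (rule set_borel_integral_eq_integral(1)[OF S])
  let ?f = "\<lambda>l. exponential_density 1 l * (if t < l then s else gf p (Y (t - l)))"
  \<comment> \<open>After the substitution v = t - l, the ancestor outlives t exactly when v < 0;
    this reflected density has total mass 1 and accounts for the term s * exp (- t).\<close>
  have E: "integrable lborel (\<lambda>v. exponential_density 1 (0 + (- 1) * v))"
    by (rule lborel_integrable_real_affine[OF integrable_exponential_density]) simp
  have E1: "(\<integral>v. exponential_density 1 (0 + (- 1) * v) \<partial>lborel) = 1"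
    using lborel_integral_real_affine[of "- 1" "exponential_density 1" 0] integral_exponential_density by simp
  have "Y t = (\<integral>v. ?f (t + (- 1) * v) \<partial>lborel)"
    unfolding Y_renewal[of t] using lborel_integral_real_affine[of "- 1" ?f t] by simp
  also have "\<dots> = (\<integral>v. exp (- t) * (s * exponential_density 1 (0 + (- 1) * v) + indicator {0..t} v *\<^sub>R ?k v) \<partial>lborel)"
  proof (rule integral_cong_AE)
    show "AE v in lborel. ?f (t + (- 1) * v) =
        exp (- t) * (s * exponential_density 1 (0 + (- 1) * v) + indicator {0..t} v *\<^sub>R ?k v)"
      \<comment> \<open>At v = 0 the reflected density and the indicator overlap, so the integrands
        agree only off this null set.\<close>
      using AE_lborel_singleton[of 0]
    proof (rule AE_mp, intro AE_I2 impI)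
      fix v :: real assume "v \<noteq> 0"
      then show "?f (t + (- 1) * v) =
          exp (- t) * (s * exponential_density 1 (0 + (- 1) * v) + indicator {0..t} v *\<^sub>R ?k v)"
        using t by (auto simp: exponential_density_def indicator_def exp_diff exp_minus field_simps)
    qed
  qed measurable
  also have "\<dots> = exp (- t) * (s * 1 + (\<integral>v. indicator {0..t} v *\<^sub>R ?k v \<partial>lborel))"
    using E E1 S unfolding set_integrable_def by simp
  also have "(\<integral>v. indicator {0..t} v *\<^sub>R ?k v \<partial>lborel) = integral {0..t} ?k"
    using set_borel_integral_eq_integral(2)[OF S] by (simp add: set_lebesgue_integral_def)
  finally show "Y t = exp (- t) * (s + integral {0..t} ?k)" by simp
qed

lemma Y_0: "Y 0 = s"
  using Y_integral(2)[of 0] by simp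

text \<open>A bootstrap: the integral equation starts from a bounded measurable integrand and gives
  continuity of Y, hence of the integrand, hence differentiability of Y.\<close>

lemma Y_cont: "continuous_on {0..T} Y"
proof (cases "0 \<le> T")
  case True
  have "continuous_on {0..T} (\<lambda>t. exp (- t) * (s + integral {0..t} (\<lambda>v. exp v * gf p (Y v))))"
    by (intro continuous_intros indefinite_integral_continuous_1 Y_integral(1) True)
  then show ?thesis
    by (rule continuous_on_eq) (use Y_integral(2) in auto)
qed simp

lemma Y_ode:
  assumes "t \<in> {0..T}"
  shows "(Y has_real_derivative gf p (Y t) - Y t) (at t within {0..T})"
proof -
  let ?k = "\<lambda>v. exp v * gf p (Y v)"
  have "continuous_on {0..T} ?k"
    by (intro continuous_intros continuous_on_compose2[OF cont Y_cont]) (use Y_bounds in auto)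
  from integral_has_real_derivative[OF this assms]
  have "((\<lambda>t. exp (- t) * (s + integral {0..t} ?k)) has_real_derivative
      exp (- t) * ?k t - exp (- t) * (s + integral {0..t} ?k)) (at t within {0..T})"
    by (auto intro!: derivative_eq_intros)
  also have "exp (- t) * ?k t - exp (- t) * (s + integral {0..t} ?k) = gf p (Y t) - Y t"
    using Y_integral(2)[of t] assms by (simp add: exp_minus)
  finally show ?thesis
    unfolding has_field_derivative_def
    by (rule has_derivative_transform[rotated 2]) (use assms Y_integral(2) in auto)
qed

end

section \<open>Solving the backward equation\<close>

text \<open>Integrating factor. As u is never divided by, its zeros need not be excluded beforehand;
  the formula excludes them when u 0 is nonzero.\<close>

lemma linear_ode_solution:
  fixes u k :: "real \<Rightarrow> real"
  assumes "0 \<le> T" and k: "continuous_on {0..T} k"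
    and u: "\<And>t. t \<in> {0..T} \<Longrightarrow> (u has_real_derivative k t * u t) (at t within {0..T})"
  shows "u T = u 0 * exp (integral {0..T} k)"
proof -
  define K where "K t = integral {0..t} k" for t
  have "((\<lambda>t. u t * exp (- K t)) has_real_derivative 0) (at t within {0..T})" if t: "t \<in> {0..T}" for t
  proof -
    have "(K has_real_derivative k t) (at t within {0..T})"
      unfolding K_def by (rule integral_has_real_derivative[OF k t])
    with u[OF t] show ?thesis by (auto intro!: derivative_eq_intros)
  qed
  then obtain c where c: "\<And>t. t \<in> {0..T} \<Longrightarrow> u t * exp (- K t) = c"
    using has_field_derivative_zero_constant[of "{0..T}" "\<lambda>t. u t * exp (- K t)"] by auto
  have "u T * exp (- K T) = u 0"
    using c[of 0] c[of T] assms(1) by (simp add: K_def)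
  then show ?thesis by (simp add: K_def exp_minus field_simps)
qed

section \<open>Explicit generating functions of the process\<close>

context noncritical_law
begin

lemma process_gf_noncritical:
  assumes mlf: "modified_linear_fractional p" and M: "branching_particles M p L N"
    and s_range: "s \<in> {0..<q} \<union> {q<..<r}" and t: "0 \<le> t"
  shows "integrable M (\<lambda>\<omega>. gpow s (population L N t \<omega>))"
    and "(process_gf M L N t s - q) / (s - q) =
      exp (- alpha p q * t) * ((r - process_gf M L N t s) / (r - s)) powr gam p q r"
proof -
  obtain c b where cb: "\<And>k. p (Suc (Suc k)) = c * b ^ k" "0 < c" "0 \<le> b" "b < 1"
    using mlf_coeffsE[OF mlf] by metis
  interpret branching_gf M p L N r s
  proof (rule branching_gf.intro[OF M], unfold_locales)
    show "0 \<le> p k" for k by (rule p_nonneg)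
    show "(\<lambda>k. p k * r ^ k) sums r" by (rule sums_r)
    show "0 \<le> s" "s \<le> r" using s_range bounds by auto
    show "continuous_on {0..r} (gf p)" by (rule continuous_on_gf_mlf[OF cb])
  qed
  have Y: "0 \<le> Y v" "Y v \<le> r" for v by (rule Y_bounds)+
  have F: "integrable M (\<lambda>\<omega>. gpow s (population L N t \<omega>))" "process_gf M L N t s = Y t"
    using process_gf_eq[OF t] by auto
  show "integrable M (\<lambda>\<omega>. gpow s (population L N t \<omega>))" by (rule F)
  \<comment> \<open>The factorisation of f(x) - x is available for x < r, while only Y <= r is known
    here; at r both sides vanish.\<close>
  have fY: "gf p (Y v) - Y v = - ((Y v - q) * (r - Y v) * gf v2 (Y v))" for v
  proof (cases "Y v = r")
    case True
    then show ?thesis by (simp add: gf_r)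
  next
    case False
    then have "Y v < r" using Y[of v] by linarith
    from gf_p[OF Y(1) this] show ?thesis by linarith
  qed
  have "continuous_on {0..r} (\<lambda>x. c / ((1 - b * q) * (1 - b * r) * (1 - b * x)))"
  proof (intro continuous_intros ballI)
    fix x assume "x \<in> {0..r}"
    then show "(1 - b * q) * (1 - b * r) * (1 - b * x) \<noteq> 0"
      using b_less[OF cb, of q] b_less[OF cb, of r] b_less[OF cb, of x] bounds by auto
  qed
  then have "continuous_on {0..r} (gf v2)"
    by (rule continuous_on_eq) (use gf_v2_mlf[OF cb, symmetric] in simp)
  then have gY: "continuous_on {0..t} (\<lambda>v. gf v2 (Y v))"
    by (rule continuous_on_compose2[OF _ Y_cont]) (use Y in auto)
  define k1 where "k1 v = - ((r - Y v) * gf v2 (Y v))" for v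
  define k2 where "k2 v = (Y v - q) * gf v2 (Y v)" for v
  have k: "continuous_on {0..t} k1" "continuous_on {0..t} k2"
    unfolding k1_def k2_def by (intro continuous_intros gY Y_cont)+
  have "Y t - q = (Y 0 - q) * exp (integral {0..t} k1)"
  proof (rule linear_ode_solution[OF t k(1)])
    fix v assume "v \<in> {0..t}"
    from Y_ode[OF this] show "((\<lambda>v. Y v - q) has_real_derivative k1 v * (Y v - q)) (at v within {0..t})"
      unfolding fY k1_def by (auto intro!: derivative_eq_intros)
  qed
  then have e1: "(Y t - q) / (s - q) = exp (integral {0..t} k1)"
    using s_range by (auto simp: Y_0)
  have "r - Y t = (r - Y 0) * exp (integral {0..t} k2)"
  proof (rule linear_ode_solution[OF t k(2)])
    fix v assume "v \<in> {0..t}"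
    from Y_ode[OF this] show "((\<lambda>v. r - Y v) has_real_derivative k2 v * (r - Y v)) (at v within {0..t})"
      unfolding fY k2_def by (auto intro!: derivative_eq_intros)
  qed
  then have e2: "(r - Y t) / (r - s) = exp (integral {0..t} k2)"
    using s_range bounds by (auto simp: Y_0)
  have "gam p q r * k2 v - k1 v = alpha p q" for v
    using gf_v2_gam_mlf[OF cb Y, of v] by (simp add: k1_def k2_def algebra_simps)
  then have "integral {0..t} (\<lambda>v. gam p q r * k2 v - k1 v) = alpha p q * t"
    using t by simp
  moreover have "integral {0..t} (\<lambda>v. gam p q r * k2 v - k1 v) =
      gam p q r * integral {0..t} k2 - integral {0..t} k1"
    using k by (simp add: Henstock_Kurzweil_Integration.integral_diff integrable_continuous_interval continuous_on_mult_left)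
  ultimately have I: "integral {0..t} k1 = - alpha p q * t + gam p q r * integral {0..t} k2" by simp
  \<comment> \<open>The quotient (r - F) / (r - s) is an exponential, hence positive, and the real
    power multiplies its exponent by gamma.\<close>
  show "(process_gf M L N t s - q) / (s - q) =
      exp (- alpha p q * t) * ((r - process_gf M L N t s) / (r - s)) powr gam p q r"
    unfolding F(2) e1 e2 I exp_add by (simp add: powr_def)
qed

end

lemma process_gf_critical:
  assumes law: "offspring_law p" and crit: "critical p" and mlf: "mlf_form p p0 p1 pd b"
    and M: "branching_particles M p L N" and s_range: "s \<in> {0..<1}" and t: "0 \<le> t"
  shows "integrable M (\<lambda>\<omega>. gpow s (population L N t \<omega>))"
    and "p0 * t = (1 - b) * ((process_gf M L N t s - s) / ((1 - s) * (1 - process_gf M L N t s)))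
        - b * ln ((1 - process_gf M L N t s) / (1 - s))"
proof -
  note co = mlf_form_coeffs[OF mlf]
  note gf = critical_mlf_coeffs(5)[OF law crit co(3,5,6), unfolded co(1)]
  have bx: "\<bar>b * x\<bar> < 1" if "x \<in> {0..1}" for x
    using that co(5,6) mult_left_mono[of x 1 b] by auto
  have "continuous_on {0..1} (\<lambda>x. x + p0 * (1 - x)\<^sup>2 / (1 - b * x))"
    by (intro continuous_intros) (use bx in force)
  then have cont: "continuous_on {0..1} (gf p)"
    by (rule continuous_on_eq) (use gf bx in auto)
  interpret branching_gf M p L N 1 s
    by (rule branching_gf.intro[OF M], unfold_locales)
      (use s_range law crit cont in \<open>auto simp: offspring_law_def critical_def\<close>)
  have Y: "0 \<le> Y v" "Y v \<le> 1" for v by (rule Y_bounds)+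
  have F: "integrable M (\<lambda>\<omega>. gpow s (population L N t \<omega>))" "process_gf M L N t s = Y t"
    using process_gf_eq[OF t] by auto
  show "integrable M (\<lambda>\<omega>. gpow s (population L N t \<omega>))" by (rule F)
  have bY: "1 - b * Y v > 0" for v using bx[of "Y v"] Y[of v] by auto
  have fY: "gf p (Y v) - Y v = p0 * (1 - Y v)\<^sup>2 / (1 - b * Y v)" for v
    using gf[OF bx, of "Y v"] Y[of v] by simp
  \<comment> \<open>The quotients and logarithms below need F < 1. Read as a linear equation for 1 -
    Y, the differential equation preserves positivity.\<close>
  have pos: "Y v < 1" if v: "v \<in> {0..t}" for v
  proof -
    have "1 - Y v = (1 - Y 0) * exp (integral {0..v} (\<lambda>v. - (p0 * (1 - Y v) / (1 - b * Y v))))"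
    proof (rule linear_ode_solution)
      show "0 \<le> v" using v by simp
      show "continuous_on {0..v} (\<lambda>v. - (p0 * (1 - Y v) / (1 - b * Y v)))"
        by (intro continuous_intros Y_cont) (use bY in \<open>auto simp: less_le\<close>)
      fix w assume "w \<in> {0..v}"
      from Y_ode[OF this] show "((\<lambda>v. 1 - Y v) has_real_derivative
          - (p0 * (1 - Y w) / (1 - b * Y w)) * (1 - Y w)) (at w within {0..v})"
        unfolding fY by (auto intro!: derivative_eq_intros simp: power2_eq_square)
    qed
    moreover have "0 < (1 - Y 0) * exp x" for x using s_range by (simp add: Y_0)
    ultimately show ?thesis by (metis diff_gt_0_iff_gt)
  qed
  \<comment> \<open>A conserved quantity from separating variables: by partial fractions, (1 - b) /
    (1 - y) - b * ln (1 - y) is an antiderivative of (1 - b * y) / (1 - y)^2.\<close>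
  define H where "H v = (1 - b) / (1 - Y v) - b * ln (1 - Y v) - p0 * v" for v
  have "(H has_real_derivative 0) (at v within {0..t})" if v: "v \<in> {0..t}" for v
  proof -
    have w: "1 - Y v > 0" using pos[OF v] by simp
    let ?d = "p0 * (1 - Y v)\<^sup>2 / (1 - b * Y v)"
    have "(H has_real_derivative (1 - b) * (?d / (1 - Y v)\<^sup>2) + b * (?d / (1 - Y v)) - p0) (at v within {0..t})"
      unfolding H_def[abs_def] using Y_ode[OF v] w unfolding fY
      by (auto intro!: derivative_eq_intros simp: power2_eq_square)
    moreover have "(1 - b) * (?d / (1 - Y v)\<^sup>2) + b * (?d / (1 - Y v)) = p0"
    proof -
      have "(1 - b) * (?d / (1 - Y v)\<^sup>2) + b * (?d / (1 - Y v)) =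
          p0 / (1 - b * Y v) * ((1 - b) + b * (1 - Y v))"
        using w by (simp add: power2_eq_square distrib_left mult_ac)
      also have "(1 - b) + b * (1 - Y v) = 1 - b * Y v" by (simp add: algebra_simps)
      also have "p0 / (1 - b * Y v) * (1 - b * Y v) = p0" using bY[of v] by simp
      finally show ?thesis .
    qed
    ultimately show ?thesis by simp
  qed
  then obtain d where d: "\<And>v. v \<in> {0..t} \<Longrightarrow> H v = d"
    using has_field_derivative_zero_constant[of "{0..t}" H] by auto
  then have "H t = H 0" using t by simp
  then have "p0 * t = (1 - b) * (1 / (1 - Y t) - 1 / (1 - s)) - b * (ln (1 - Y t) - ln (1 - s))"
    by (simp add: H_def Y_0 algebra_simps)
  moreover have "1 - Y t > 0" "1 - s > 0" using pos[of t] t s_range by auto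
  moreover from this have "1 / (1 - Y t) - 1 / (1 - s) = (Y t - s) / ((1 - s) * (1 - Y t))"
    by (simp add: divide_simps)
  ultimately show "p0 * t = (1 - b) * ((process_gf M L N t s - s) / ((1 - s) * (1 - process_gf M L N t s)))
        - b * ln ((1 - process_gf M L N t s) / (1 - s))"
    unfolding F(2) by (simp add: ln_div)
qed

section \<open>Both equivalences with the resulting formulas\<close>

theorem proposition11:
  fixes p :: "nat \<Rightarrow> real" and q r :: real
  assumes "offspring_law p"
  shows
    "(noncritical p q r \<longrightarrow>
        ((\<forall>x\<in>{0..<r}. psi p q r x = 0) \<longleftrightarrow> modified_linear_fractional p) \<and>
        (modified_linear_fractional p \<longrightarrow>
          (\<forall>(M :: 'a measure) L N. branching_particles M p L N \<longrightarrow>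
            (\<forall>s\<in>{0..<q} \<union> {q<..<r}. \<forall>t\<ge>0.
               integrable M (\<lambda>\<omega>. gpow s (population L N t \<omega>)) \<and>
               (process_gf M L N t s - q) / (s - q) =
                 exp (- alpha p q * t) *
                 ((r - process_gf M L N t s) / (r - s)) powr gam p q r)))) \<and>
     (critical p \<longrightarrow>
        ((\<forall>x\<in>{0..<1}. psi_crit p x = 0) \<longleftrightarrow> modified_linear_fractional p) \<and>
        (\<forall>p0 p1 p\<Delta> b. mlf_form p p0 p1 p\<Delta> b \<longrightarrow>
          (\<forall>s\<ge>0. b * s < 1 \<longrightarrow>
             gf p s = s + p0 * (1 - s)\<^sup>2 * inverse (1 - b * s)) \<and>
          (\<forall>(M :: 'a measure) L N. branching_particles M p L N \<longrightarrow>
            (\<forall>s\<in>{0..<1}. \<forall>t\<ge>0.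
               integrable M (\<lambda>\<omega>. gpow s (population L N t \<omega>)) \<and>
               p0 * t =
                 (1 - b) * ((process_gf M L N t s - s) /
                            ((1 - s) * (1 - process_gf M L N t s)))
                 - b * ln ((1 - process_gf M L N t s) / (1 - s))))))"
proof (intro conjI impI)
  assume nc: "noncritical p q r"
  interpret noncritical_law p q r by unfold_locales fact+
  show "(\<forall>x\<in>{0..<r}. psi p q r x = 0) \<longleftrightarrow> modified_linear_fractional p"
  proof
    assume "\<forall>x\<in>{0..<r}. psi p q r x = 0"
    then show "modified_linear_fractional p" by (intro mlf_if_psi_zero) auto
  next
    assume "modified_linear_fractional p"
    then obtain c b where cb: "\<And>k. p (Suc (Suc k)) = c * b ^ k" "0 < c" "0 \<le> b" "b < 1"
      by (rule mlf_coeffsE) metis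
    show "\<forall>x\<in>{0..<r}. psi p q r x = 0" using psi_zero_if_mlf[OF cb] by auto
  qed
  assume "modified_linear_fractional p"
  then show "\<forall>(M :: 'a measure) L N. branching_particles M p L N \<longrightarrow>
      (\<forall>s\<in>{0..<q} \<union> {q<..<r}. \<forall>t\<ge>0.
         integrable M (\<lambda>\<omega>. gpow s (population L N t \<omega>)) \<and>
         (process_gf M L N t s - q) / (s - q) =
           exp (- alpha p q * t) * ((r - process_gf M L N t s) / (r - s)) powr gam p q r)"
    by (intro allI impI ballI conjI process_gf_noncritical)
next
  assume crit: "critical p"
  show "(\<forall>x\<in>{0..<1}. psi_crit p x = 0) \<longleftrightarrow> modified_linear_fractional p"
    using mlf_if_psi_crit_zero[OF assms crit] psi_crit_zero_if_mlf[OF assms crit] by auto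
  show "\<forall>p0 p1 p\<Delta> b. mlf_form p p0 p1 p\<Delta> b \<longrightarrow>
      (\<forall>s\<ge>0. b * s < 1 \<longrightarrow> gf p s = s + p0 * (1 - s)\<^sup>2 * inverse (1 - b * s)) \<and>
      (\<forall>(M :: 'a measure) L N. branching_particles M p L N \<longrightarrow>
        (\<forall>s\<in>{0..<1}. \<forall>t\<ge>0.
           integrable M (\<lambda>\<omega>. gpow s (population L N t \<omega>)) \<and>
           p0 * t = (1 - b) * ((process_gf M L N t s - s) / ((1 - s) * (1 - process_gf M L N t s)))
             - b * ln ((1 - process_gf M L N t s) / (1 - s))))"
  proof (intro allI impI conjI ballI)
    fix p0 p1 p\<Delta> b s :: real
    assume mlf: "mlf_form p p0 p1 p\<Delta> b" and s: "0 \<le> s" "b * s < 1"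
    note co = mlf_form_coeffs[OF mlf]
    show "gf p s = s + p0 * (1 - s)\<^sup>2 * inverse (1 - b * s)"
      using critical_mlf_coeffs(5)[OF assms crit co(3,5,6), of s] s co(1,5)
      by (simp add: divide_inverse)
  qed (rule process_gf_critical[OF assms crit]; assumption)+
qed

end
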